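(* Let $q\ge 2$ be an integer and let $f,g\in L^\infty(\mathbb{T})$. Then the equality of bounded operators on $\ell^2(T_q)$ $$\Gamma_q[\bar f g]=\Gamma_q[\bar f]\,\Gamma_q[g]$$ holds if and only if either $f\in H^\infty(\mathbb{T})$ or $g\in H^\infty(\mathbb{T})$.
   Context: $T_q$ denotes the (vertex set of the) infinite rooted $q$-homogeneous tree: there is a root $o$, and each vertex has exactly $q$ children. $d$ is the graph distance and $|\sigma| := d(o,\sigma)$. Write $\sigma_1\preccurlyeq\sigma_2$ if $\sigma_1,\sigma_2$ lie on a common geodesic ray starting at the root and $|\sigma_1|\le|\sigma_2|$. Let $\mathcal{C}\subset T_q\times T_q$ be the set of comparable pairs ($\sigma_1\preccurlyeq\sigma_2$ or $\sigma_2\preccurlyeq\sigma_1$), with indicator function $\mathbf{1}_{\mathcal{C}}$. $\mathbb{T}=\mathbb{R}/2\pi\mathbb{Z}$. For $f\in L^\infty(\mathbb{T})$, $\widehat f(n)=\int_{\mathbb{T}} f(e^{i\theta})e^{-in\theta}\frac{d\theta}{2\pi}$, and $$\Gamma_q[f](\sigma_1,\sigma_2) := q^{-d(\sigma_1,\sigma_2)/2}\,\widehat f(|\sigma_1|-|\sigma_2|)\,\mathbf{1}_{\mathcal{C}}(\sigma_1,\sigma_2).$$ Bounded operators $A$ on $\ell^2(T_q)$ are identified with their kernels $A(\sigma_1,\sigma_2)=\langle A\delta_{\sigma_2},\delta_{\sigma_1}\rangle$; for every $f\in L^\infty(\mathbb{T})$ the kernel $\Gamma_q[f]$ represents a bounded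 operator on $\ell^2(T_q)$. $H^\infty(\mathbb{T})=\{f\in L^\infty(\mathbb{T}) : \widehat f(n)=0 \text{ for all } n<0\}$. *)

theory Defs
  imports "HOL-Analysis.Analysis" "HOL-Library.FuncSet" "HOL-Library.Sublist"
begin

section \<open>The rooted homogeneous tree\<close>

text \<open>
  The vertices of the rooted \<open>q\<close>-homogeneous tree are the finite words over the alphabet
  \<open>{0, ..., q - 1}\<close>. The root is the empty word and the \<open>q\<close> children of a word \<open>\<sigma>\<close> are the
  words \<open>\<sigma> @ [i]\<close> with \<open>i < q\<close>.
\<close>

type_synonym vertex = "nat list"

definition tree :: "nat \<Rightarrow> vertex set" where
  "tree q = lists {..<q}"

definition tree_edges :: "nat \<Rightarrow> (vertex \<times> vertex) set" where
  "tree_edges q = {(\<sigma>, \<tau>). \<sigma> \<in> tree q \<and> \<tau> \<in> tree q \<and>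
                            ((\<exists>i. \<tau> = \<sigma> @ [i]) \<or> (\<exists>i. \<sigma> = \<tau> @ [i]))}"

definition tree_dist :: "nat \<Rightarrow> vertex \<Rightarrow> vertex \<Rightarrow> nat" where
  "tree_dist q \<sigma> \<tau> = (LEAST n. (\<sigma>, \<tau>) \<in> tree_edges q ^^ n)"

definition level :: "nat \<Rightarrow> vertex \<Rightarrow> nat" where
  "level q \<sigma> = tree_dist q [] \<sigma>"

definition geodesic_ray :: "nat \<Rightarrow> (nat \<Rightarrow> vertex) \<Rightarrow> bool" where
  "geodesic_ray q r \<longleftrightarrow>
     r 0 = [] \<and> range r \<subseteq> tree q \<and> (\<forall>m n. m \<le> n \<longrightarrow> tree_dist q (r m) (r n) = n - m)"

definition tree_le :: "nat \<Rightarrow> vertex \<Rightarrow> vertex \<Rightarrow> bool" where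
  "tree_le q \<sigma> \<tau> \<longleftrightarrow>
     (\<exists>r. geodesic_ray q r \<and> \<sigma> \<in> range r \<and> \<tau> \<in> range r) \<and> level q \<sigma> \<le> level q \<tau>"

definition comparable :: "nat \<Rightarrow> vertex \<Rightarrow> vertex \<Rightarrow> bool" where
  "comparable q \<sigma> \<tau> \<longleftrightarrow> tree_le q \<sigma> \<tau> \<or> tree_le q \<tau> \<sigma>"


section \<open>Functions on the circle\<close>

text \<open>
  A function on the circle is represented by some \<open>f :: complex \<Rightarrow> complex\<close>, of which only
  the values \<open>f (cis \<theta>)\<close> matter. Elements of \<open>L\<^sup>\<infinity>\<close> are given by representatives;
  everything below depends only on the almost-everywhere class.
\<close>

definition Linf :: "(complex \<Rightarrow> complex) set" where
  "Linf = {f. (\<lambda>\<theta>. f (cis \<theta>)) \<in> borel_measurable (lebesgue_on {0..2 * pi}) \<and>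
              (\<exists>C. AE \<theta> in lebesgue_on {0..2 * pi}. cmod (f (cis \<theta>)) \<le> C)}"

definition fourier_coeff :: "(complex \<Rightarrow> complex) \<Rightarrow> int \<Rightarrow> complex" where
  "fourier_coeff f n =
     (LINT \<theta>|lebesgue_on {0..2 * pi}. f (cis \<theta>) * exp (- \<i> * of_int n * of_real \<theta>)) / (2 * pi)"

definition Hinf :: "(complex \<Rightarrow> complex) set" where
  "Hinf = {f \<in> Linf. \<forall>n<0. fourier_coeff f n = 0}"


section \<open>Bounded operators on the square-summable functions\<close>

text \<open>
  The space \<open>\<ell>\<^sup>2\<close> of the tree consists of the square-summable functions on the vertices,
  extended by \<open>0\<close> to all words. A bounded operator is an extensional function on this
  space, so that equality of operators is equality in HOL and their product is
  \<open>compose (ell2 q)\<close>.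
\<close>

definition ell2 :: "nat \<Rightarrow> (vertex \<Rightarrow> complex) set" where
  "ell2 q = {x. (\<forall>\<sigma>. \<sigma> \<notin> tree q \<longrightarrow> x \<sigma> = 0) \<and> (\<lambda>\<sigma>. (cmod (x \<sigma>))\<^sup>2) summable_on tree q}"

definition ell2_inner :: "nat \<Rightarrow> (vertex \<Rightarrow> complex) \<Rightarrow> (vertex \<Rightarrow> complex) \<Rightarrow> complex" where
  "ell2_inner q x y = (\<Sum>\<^sub>\<infinity>\<sigma>\<in>tree q. x \<sigma> * cnj (y \<sigma>))"

definition ell2_norm :: "nat \<Rightarrow> (vertex \<Rightarrow> complex) \<Rightarrow> real" where
  "ell2_norm q x = sqrt (\<Sum>\<^sub>\<infinity>\<sigma>\<in>tree q. (cmod (x \<sigma>))\<^sup>2)"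

definition delta :: "vertex \<Rightarrow> vertex \<Rightarrow> complex" where
  "delta \<tau> = (\<lambda>\<sigma>. if \<sigma> = \<tau> then 1 else 0)"

definition bounded_operators :: "nat \<Rightarrow> ((vertex \<Rightarrow> complex) \<Rightarrow> (vertex \<Rightarrow> complex)) set" where
  "bounded_operators q = {A \<in> ell2 q \<rightarrow>\<^sub>E ell2 q.
     (\<forall>x\<in>ell2 q. \<forall>y\<in>ell2 q. A (\<lambda>\<sigma>. x \<sigma> + y \<sigma>) = (\<lambda>\<sigma>. A x \<sigma> + A y \<sigma>)) \<and>
     (\<forall>c. \<forall>x\<in>ell2 q. A (\<lambda>\<sigma>. c * x \<sigma>) = (\<lambda>\<sigma>. c * A x \<sigma>)) \<and>
     (\<exists>C. \<forall>x\<in>ell2 q. ell2_norm q (A x) \<le> C * ell2_norm q x)}"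

definition kernel_of ::
  "nat \<Rightarrow> ((vertex \<Rightarrow> complex) \<Rightarrow> (vertex \<Rightarrow> complex)) \<Rightarrow> vertex \<Rightarrow> vertex \<Rightarrow> complex" where
  "kernel_of q A \<sigma> \<tau> = ell2_inner q (A (delta \<tau>)) (delta \<sigma>)"

text \<open>
  A bounded operator is determined by its kernel, so the description below denotes the
  operator with kernel \<open>K\<close> whenever there is a bounded one.
\<close>

definition operator_of_kernel ::
  "nat \<Rightarrow> (vertex \<Rightarrow> vertex \<Rightarrow> complex) \<Rightarrow> (vertex \<Rightarrow> complex) \<Rightarrow> (vertex \<Rightarrow> complex)" where
  "operator_of_kernel q K =
     (THE A. A \<in> bounded_operators q \<and> (\<forall>\<sigma>\<in>tree q. \<forall>\<tau>\<in>tree q. kernel_of q A \<sigma> \<tau> = K \<sigma> \<tau>))"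


section \<open>The operators \<open>\<Gamma>\<^sub>q[f]\<close>\<close>

definition Gamma_kernel :: "nat \<Rightarrow> (complex \<Rightarrow> complex) \<Rightarrow> vertex \<Rightarrow> vertex \<Rightarrow> complex" where
  "Gamma_kernel q f \<sigma> \<tau> =
     of_real (real q powr (- (real (tree_dist q \<sigma> \<tau>) / 2))) *
     fourier_coeff f (int (level q \<sigma>) - int (level q \<tau>)) *
     of_bool (comparable q \<sigma> \<tau>)"

text \<open>
  For \<open>f \<in> Linf\<close> the kernel \<open>Gamma_kernel q f\<close> is that of a bounded operator.
\<close>

definition Gamma_op ::
  "nat \<Rightarrow> (complex \<Rightarrow> complex) \<Rightarrow> (vertex \<Rightarrow> complex) \<Rightarrow> (vertex \<Rightarrow> complex)" where
  "Gamma_op q f = operator_of_kernel q (Gamma_kernel q f)"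


section \<open>The tree notions in terms of words\<close>

lemma edge_power_length:
  "(\<sigma>, \<tau>) \<in> tree_edges q ^^ n \<Longrightarrow> length \<tau> \<le> length \<sigma> + n"
proof (induction n arbitrary: \<tau>)
  case (Suc n)
  then obtain \<rho> where "(\<sigma>, \<rho>) \<in> tree_edges q ^^ n" "(\<rho>, \<tau>) \<in> tree_edges q" by auto
  with Suc.IH[of \<rho>] show ?case by (auto simp: tree_edges_def)
qed auto

lemma edge_power_append:
  "\<sigma> @ \<rho> \<in> tree q \<Longrightarrow> (\<sigma>, \<sigma> @ \<rho>) \<in> tree_edges q ^^ length \<rho>"
proof (induction \<rho> rule: rev_induct)
  case (snoc i \<rho>)
  then have "(\<sigma> @ \<rho>, \<sigma> @ \<rho> @ [i]) \<in> tree_edges q" "\<sigma> @ \<rho> \<in> tree q"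
    by (auto simp: tree_edges_def tree_def)
  with snoc show ?case by auto
qed auto

lemma tree_dist_append:
  assumes "\<sigma> @ \<rho> \<in> tree q"
  shows "tree_dist q \<sigma> (\<sigma> @ \<rho>) = length \<rho>"
  unfolding tree_dist_def
proof (rule Least_equality)
  show "(\<sigma>, \<sigma> @ \<rho>) \<in> tree_edges q ^^ length \<rho>" by (rule edge_power_append[OF assms])
next
  fix n assume "(\<sigma>, \<sigma> @ \<rho>) \<in> tree_edges q ^^ n"
  from edge_power_length[OF this] show "length \<rho> \<le> n" by simp
qed

lemma level_eq_length: "\<sigma> \<in> tree q \<Longrightarrow> level q \<sigma> = length \<sigma>"
  using tree_dist_append[of "[]" \<sigma>] by (simp add: level_def)

lemma edge_power_sym: "(\<sigma>, \<tau>) \<in> tree_edges q ^^ n \<Longrightarrow> (\<tau>, \<sigma>) \<in> tree_edges q ^^ n"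
proof (induction n arbitrary: \<tau>)
  case (Suc n)
  then obtain \<rho> where "(\<sigma>, \<rho>) \<in> tree_edges q ^^ n" "(\<rho>, \<tau>) \<in> tree_edges q" by auto
  with Suc.IH[of \<rho>] have "(\<tau>, \<rho>) \<in> tree_edges q" "(\<rho>, \<sigma>) \<in> tree_edges q ^^ n"
    by (auto simp: tree_edges_def)
  then show ?case by (rule relpow_Suc_I2)
qed auto

lemma tree_dist_commute: "tree_dist q \<sigma> \<tau> = tree_dist q \<tau> \<sigma>"
  unfolding tree_dist_def using edge_power_sym by (metis (no_types, lifting))

lemma edge_power_exists:
  assumes "\<sigma> \<in> tree q" "\<tau> \<in> tree q"
  shows "(\<sigma>, \<tau>) \<in> tree_edges q ^^ tree_dist q \<sigma> \<tau>"
proof -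
  have "(\<sigma>, []) \<in> tree_edges q ^^ length \<sigma>" "([], \<tau>) \<in> tree_edges q ^^ length \<tau>"
    using edge_power_append[of "[]"] assms edge_power_sym by auto
  then have "(\<sigma>, \<tau>) \<in> tree_edges q ^^ (length \<sigma> + length \<tau>)"
    by (auto simp: relpow_add)
  then show ?thesis unfolding tree_dist_def by (rule LeastI)
qed

lemma geodesic_ray_prefix:
  assumes r: "geodesic_ray q r" and "m \<le> n"
  shows "prefix (r m) (r n)"
proof -
  have tree: "r k \<in> tree q" for k using r by (auto simp: geodesic_ray_def)
  have len: "length (r k) = k" for k
    using r tree[of k] level_eq_length[of "r k" q] unfolding geodesic_ray_def level_def
    by (metis diff_zero le0)
  have "prefix (r k) (r (Suc k))" for k
  proof -
    have "tree_dist q (r k) (r (Suc k)) = 1"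
      using r by (simp add: geodesic_ray_def)
    with edge_power_exists[OF tree tree, of k "Suc k"]
    have "(r k, r (Suc k)) \<in> tree_edges q" by simp
    then show ?thesis
      using len[of k] len[of "Suc k"] by (auto simp: tree_edges_def)
  qed
  with \<open>m \<le> n\<close> show ?thesis
    by (induction rule: dec_induct) (auto intro: prefix_order.trans)
qed

lemma tree_le_iff_prefix:
  assumes "q > 0" "\<sigma> \<in> tree q" "\<tau> \<in> tree q"
  shows "tree_le q \<sigma> \<tau> \<longleftrightarrow> prefix \<sigma> \<tau>"
proof
  assume "tree_le q \<sigma> \<tau>"
  then obtain r m n where r: "geodesic_ray q r" "\<sigma> = r m" "\<tau> = r n"
    and "level q \<sigma> \<le> level q \<tau>" by (auto simp: tree_le_def)
  then have "length \<sigma> \<le> length \<tau>" using assms by (simp add: level_eq_length)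
  moreover have "prefix \<sigma> \<tau> \<or> prefix \<tau> \<sigma>"
    using geodesic_ray_prefix[OF r(1)] r nat_le_linear by metis
  ultimately show "prefix \<sigma> \<tau>"
    by (metis prefix_length_le prefix_length_prefix prefix_order.refl)
next
  assume "prefix \<sigma> \<tau>"
  then obtain \<rho> where \<rho>: "\<tau> = \<sigma> @ \<rho>" by (auto simp: prefix_def)
  define a where "a i = (if i < length \<tau> then \<tau> ! i else 0)" for i
  define r where "r n = map a [0..<n]" for n
  have "a i < q" for i
    using assms(1,3) by (auto simp: a_def tree_def lists_eq_set dest: subsetD[OF _ nth_mem])
  then have tree: "r n \<in> tree q" for n by (auto simp: r_def tree_def)
  have r_le: "\<exists>\<xi>. r n = r m @ \<xi> \<and> length \<xi> = n - m" if "m \<le> n" for m n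
    using upt_add_eq_append[of 0 m "n - m"] that
    by (intro exI[of _ "map a [m..<n]"]) (simp add: r_def)
  have "geodesic_ray q r"
    unfolding geodesic_ray_def
  proof (intro conjI allI impI)
    fix m n :: nat assume "m \<le> n"
    from r_le[OF this] tree[of n] show "tree_dist q (r m) (r n) = n - m"
      by (metis tree_dist_append)
  qed (use tree in \<open>auto simp: r_def\<close>)
  moreover have "\<sigma> = r (length \<sigma>)" "\<tau> = r (length \<tau>)"
    by (auto simp: r_def a_def \<rho> nth_append intro!: nth_equalityI)
  moreover have "level q \<sigma> \<le> level q \<tau>"
    using assms \<rho> by (simp add: level_eq_length)
  ultimately show "tree_le q \<sigma> \<tau>"
    unfolding tree_le_def by blast
qed

end

theory Submission
  imports Defs
begin

text \<open>
  Let \<open>S\<close> be the isometry \<open>(S x) (\<sigma> @ [i]) = q\<^sup>-\<^sup>1\<^sup>/\<^sup>2 x \<sigma>\<close>. Then \<open>\<Gamma>\<^sub>q[f]\<close> is the operator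
  obtained from the Fourier series of \<open>f\<close> by putting \<open>S\<^sup>n\<close> for \<open>z\<^sup>n\<close> and the adjoint of \<open>S\<^sup>n\<close> for
  \<open>z\<^sup>-\<^sup>n\<close>. As \<open>S\<close> is a pure isometry, \<open>\<Gamma>\<^sub>q[f]\<close> is a direct sum of copies of the Toeplitz
  operator of \<open>f\<close>, and the statement is the Brown--Halmos theorem on products of Toeplitz
  operators. The argument below stays with kernels and never forms the decomposition.

  Write \<open>a\<close>, \<open>b\<close>, \<open>c\<close> for the Fourier coefficients of \<open>cnj f\<close>, \<open>g\<close> and their product. Comparing
  kernels, the equality of operators says that \<open>\<Sum>\<omega>. K\<^sub>a(\<sigma>, \<omega>) K\<^sub>b(\<omega>, \<tau>) = K\<^sub>c(\<sigma>, \<tau>)\<close> for all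
  vertices, where \<open>K\<^sub>a\<close> is \<open>tree_Toeplitz q a\<close>. At a pair \<open>\<sigma> = u @ r\<close>, \<open>\<tau> = u\<close> with
  \<open>|r| = n\<close>, the sum is
  \<open>q\<^sup>-\<^sup>n\<^sup>/\<^sup>2 ((\<Sum>m = 1..|u|. q\<^sup>-\<^sup>m a\<^bsub>n+m\<^esub> b\<^bsub>-m\<^esub>) + (\<Sum>k \<ge> 0. a\<^bsub>n-k\<^esub> b\<^bsub>k\<^esub>))\<close>,
  the first part coming from the vertices strictly above \<open>u\<close>
  (\<open>tree_Toeplitz_product_below\<close>). The right-hand side \<open>q\<^sup>-\<^sup>n\<^sup>/\<^sup>2 c\<^sub>n\<close> does not depend on the depth
  of \<open>u\<close>, so letting \<open>|u|\<close> grow by one step forces \<open>a\<^bsub>n+m\<^esub> b\<^bsub>-m\<^esub> = 0\<close>. Together with the mirror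
  image of this argument, every product of an \<open>a\<^sub>s\<close> and a \<open>b\<^bsub>-t\<^esub>\<close> with \<open>s, t \<ge> 1\<close> vanishes, which
  means that all these \<open>a\<^sub>s\<close> vanish or all these \<open>b\<^bsub>-t\<^esub>\<close> do: \<open>f\<close> or \<open>g\<close> lies in \<open>H\<^sup>\<infinity>\<close>.
  Conversely, if these products vanish, only the second part remains, and it is the full
  convolution \<open>c\<^sub>n = \<Sum>k. a\<^bsub>n-k\<^esub> b\<^bsub>k\<^esub>\<close> because the terms with \<open>k < 0\<close> are zero
  (\<open>tree_Toeplitz_product_iff\<close>).

  Two analytic facts are needed. The convolution formula for the coefficients of a product of
  bounded functions (\<open>has_sum_fourier_coeff_mult\<close>) is a form of Parseval's identity and rests on
  the density of the trigonometric polynomials in \<open>L\<^sup>2\<close>. The existence of the operators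
  (\<open>Gamma_op_bounded\<close>) follows by writing \<open>K\<^sub>a\<close> as an average over the words of a large fixed
  length, which stand for the boundary points of the tree, of ordinary Toeplitz matrices along
  the path to that word.
\<close>

section \<open>The mean over the circle\<close>

abbreviation circle_measure :: "real measure" where
  "circle_measure \<equiv> lebesgue_on {0..2 * pi}"

definition circle_mean :: "(complex \<Rightarrow> complex) \<Rightarrow> complex" where
  "circle_mean f = (LINT \<theta>|circle_measure. f (cis \<theta>)) / (2 * pi)"

lemma finite_circle_measure: "finite_measure circle_measure"
  by (rule finite_measure_lebesgue_on) simp

lemma measure_circle: "measure circle_measure (space circle_measure) = 2 * pi"
  by (simp add: measure_restrict_space)

lemma Linf_measurable:
  "f \<in> Linf \<Longrightarrow> (\<lambda>\<theta>. f (cis \<theta>)) \<in> borel_measurable circle_measure"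
  by (simp add: Linf_def)

lemma Linf_bound:
  assumes "f \<in> Linf"
  obtains C where "C > 0" "AE \<theta> in circle_measure. cmod (f (cis \<theta>)) \<le> C"
proof -
  obtain C where C: "AE \<theta> in circle_measure. cmod (f (cis \<theta>)) \<le> C"
    using assms by (auto simp: Linf_def)
  then have "AE \<theta> in circle_measure. cmod (f (cis \<theta>)) \<le> max C 1"
    by eventually_elim auto
  then show thesis by (rule that[rotated]) simp
qed

lemma Linf_I:
  assumes "(\<lambda>\<theta>. f (cis \<theta>)) \<in> borel_measurable circle_measure"
    "AE \<theta> in circle_measure. cmod (f (cis \<theta>)) \<le> C"
  shows "f \<in> Linf"
  using assms by (auto simp: Linf_def)

lemma Linf_cong:
  assumes "\<And>z. cmod z = 1 \<Longrightarrow> f z = g z" "g \<in> Linf"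
  shows "f \<in> Linf"
proof -
  have "f (cis \<theta>) = g (cis \<theta>)" for \<theta> using assms(1) by simp
  with assms(2) show ?thesis by (simp only: Linf_def mem_Collect_eq)
qed

lemma Linf_const [simp]: "(\<lambda>z. c) \<in> Linf"
  by (rule Linf_I[where C = "cmod c"]) auto

lemma Linf_add [simp]:
  assumes "f \<in> Linf" "g \<in> Linf"
  shows "(\<lambda>z. f z + g z) \<in> Linf"
proof -
  obtain C D where "AE \<theta> in circle_measure. cmod (f (cis \<theta>)) \<le> C"
    "AE \<theta> in circle_measure. cmod (g (cis \<theta>)) \<le> D"
    using assms by (auto simp: Linf_def)
  then have "AE \<theta> in circle_measure. cmod (f (cis \<theta>) + g (cis \<theta>)) \<le> C + D"
    by eventually_elim (rule norm_triangle_le, simp)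
  then show ?thesis
    using assms[THEN Linf_measurable] by (intro Linf_I) auto
qed

lemma Linf_mult [simp]:
  assumes "f \<in> Linf" "g \<in> Linf"
  shows "(\<lambda>z. f z * g z) \<in> Linf"
proof -
  obtain C where "C > 0" "AE \<theta> in circle_measure. cmod (f (cis \<theta>)) \<le> C"
    using Linf_bound[OF assms(1)] .
  moreover obtain D where "AE \<theta> in circle_measure. cmod (g (cis \<theta>)) \<le> D"
    using Linf_bound[OF assms(2)] .
  ultimately have "AE \<theta> in circle_measure. cmod (f (cis \<theta>) * g (cis \<theta>)) \<le> C * D"
    by (auto elim!: eventually_elim2 simp: norm_mult intro!: mult_mono)
  then show ?thesis
    using assms[THEN Linf_measurable] by (intro Linf_I) auto
qed

lemma Linf_cnj [simp]:
  assumes "f \<in> Linf"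
  shows "(\<lambda>z. cnj (f z)) \<in> Linf"
proof -
  have "(\<lambda>\<theta>. cnj (f (cis \<theta>))) \<in> borel_measurable circle_measure"
    by (rule measurable_compose[OF Linf_measurable[OF assms]])
      (intro borel_measurable_continuous_onI continuous_intros)
  then show ?thesis using assms by (auto simp: Linf_def)
qed

lemma Linf_diff [simp]: "f \<in> Linf \<Longrightarrow> g \<in> Linf \<Longrightarrow> (\<lambda>z. f z - g z) \<in> Linf"
  using Linf_add[of f "\<lambda>z. -1 * g z"] Linf_mult[of "\<lambda>z. -1" g] by simp

lemma Linf_sum [simp]: "(\<And>i. i \<in> I \<Longrightarrow> f i \<in> Linf) \<Longrightarrow> (\<lambda>z. \<Sum>i\<in>I. f i z) \<in> Linf"
  by (induction I rule: infinite_finite_induct) auto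

lemma Linf_powi [simp]: "(\<lambda>z. z powi n) \<in> Linf"
proof (rule Linf_I[where C = 1])
  have "continuous_on {0..2 * pi} (\<lambda>\<theta>. cis \<theta> powi n)"
    by (simp add: cis_power_int) (intro continuous_intros)
  then show "(\<lambda>\<theta>. cis \<theta> powi n) \<in> borel_measurable circle_measure"
    by (rule continuous_imp_measurable_on_sets_lebesgue) simp
qed (simp add: norm_power_int)

lemma Linf_integrable: 
  assumes "f \<in> Linf" shows "integrable circle_measure (\<lambda>\<theta>. f (cis \<theta>))"
proof -
  interpret finite_measure circle_measure by (rule finite_circle_measure)
  obtain C where "AE \<theta> in circle_measure. cmod (f (cis \<theta>)) \<le> C"
    using assms by (auto simp: Linf_def)
  then show ?thesis
    by (rule integrable_const_bound) (rule Linf_measurable[OF assms])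
qed

lemma circle_mean_cong:
  "(\<And>z. cmod z = 1 \<Longrightarrow> f z = g z) \<Longrightarrow> circle_mean f = circle_mean g"
  by (simp add: circle_mean_def)

lemma circle_mean_add:
  "f \<in> Linf \<Longrightarrow> g \<in> Linf \<Longrightarrow> circle_mean (\<lambda>z. f z + g z) = circle_mean f + circle_mean g"
  by (simp add: circle_mean_def Linf_integrable add_divide_distrib)

lemma circle_mean_diff:
  "f \<in> Linf \<Longrightarrow> g \<in> Linf \<Longrightarrow> circle_mean (\<lambda>z. f z - g z) = circle_mean f - circle_mean g"
  by (simp add: circle_mean_def Linf_integrable diff_divide_distrib)

lemma circle_mean_cmult: "circle_mean (\<lambda>z. c * f z) = c * circle_mean f"
  by (simp add: circle_mean_def)

lemma circle_mean_cnj: "circle_mean (\<lambda>z. cnj (f z)) = cnj (circle_mean f)"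
  by (simp add: circle_mean_def)

lemma circle_mean_sum:
  assumes "\<And>i. i \<in> I \<Longrightarrow> f i \<in> Linf"
  shows "circle_mean (\<lambda>z. \<Sum>i\<in>I. f i z) = (\<Sum>i\<in>I. circle_mean (f i))"
  using assms
  by (induction I rule: infinite_finite_induct)
    (auto simp: circle_mean_add, auto simp: circle_mean_def)

text \<open>
  The majorant \<open>h\<close> is complex valued so that it can be an element of \<open>Linf\<close> and be averaged by
  the same functional; only its real part matters.
\<close>

lemma norm_circle_mean_le:
  assumes "f \<in> Linf" "h \<in> Linf"
    and le: "AE \<theta> in circle_measure. cmod (f (cis \<theta>)) \<le> Re (h (cis \<theta>))"
  shows "cmod (circle_mean f) \<le> Re (circle_mean h)"
proof -
  have "cmod (LINT \<theta>|circle_measure. f (cis \<theta>)) \<le> (LINT \<theta>|circle_measure. cmod (f (cis \<theta>)))"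
    by (rule integral_norm_bound)
  also have "\<dots> \<le> (LINT \<theta>|circle_measure. Re (h (cis \<theta>)))"
    using assms by (intro integral_mono_AE) (auto intro: Linf_integrable)
  also have "\<dots> = Re (LINT \<theta>|circle_measure. h (cis \<theta>))"
    using assms by (intro integral_Re) (auto intro: Linf_integrable)
  finally show ?thesis
    by (simp add: circle_mean_def norm_divide divide_right_mono)
qed

text \<open>
  Orthonormality of the characters: for \<open>n \<noteq> 0\<close> the function \<open>z\<^sup>n\<close> has the periodic primitive
  \<open>\<theta> \<mapsto> cis (n \<theta>) / (\<i> n)\<close>.
\<close>

lemma circle_mean_powi: "circle_mean (\<lambda>z. z powi n) = of_bool (n = 0)"
proof (cases "n = 0")
  case True
  then show ?thesis using measure_circle by (simp add: circle_mean_def scaleR_conv_of_real)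
next
  case False
  define F where "F \<theta> = cis (of_int n * \<theta>) / (\<i> * of_int n)" for \<theta> :: real
  have "((\<lambda>\<theta>. cis \<theta> powi n) has_integral F (2 * pi) - F 0) {0..2 * pi}"
  proof (rule fundamental_theorem_of_calculus)
    fix \<theta> :: real
    have "(F has_vector_derivative (of_int n * (\<i> * cis (of_int n * \<theta>))) / (\<i> * of_int n))
        (at \<theta> within {0..2 * pi})"
      unfolding F_def
      by (auto intro!: derivative_eq_intros simp: has_vector_derivative_def scaleR_conv_of_real
          field_simps)
    then show "(F has_vector_derivative cis \<theta> powi n) (at \<theta> within {0..2 * pi})"
      using False by (simp add: cis_power_int)
  qed simp
  moreover have "F (2 * pi) = F 0"
    using cis_multiple_2pi[of "of_int n"] by (simp add: F_def mult_ac)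
  ultimately have "integral {0..2 * pi} (\<lambda>\<theta>. cis \<theta> powi n) = 0"
    by (simp add: has_integral_iff)
  then have "(LINT \<theta>|circle_measure. cis \<theta> powi n) = 0"
    using lebesgue_integral_eq_integral[OF Linf_integrable[OF Linf_powi]] by simp
  then show ?thesis using False by (simp add: circle_mean_def)
qed

lemma fourier_coeff_eq_mean: "fourier_coeff f n = circle_mean (\<lambda>z. f z * z powi (- n))"
proof -
  have "exp (- \<i> * of_int n * of_real \<theta>) = cis \<theta> powi (- n)" for \<theta>
    by (subst cis_power_int) (simp add: cis_conv_exp mult_ac)
  then show ?thesis by (simp add: fourier_coeff_def circle_mean_def)
qed

lemma cnj_powi_unit: "cmod z = 1 \<Longrightarrow> cnj (z powi n) = z powi (- n)"
  by (metis complex_cnj_power_int complex_div_cnj inverse_eq_divide mult_1 power_int_inverse power_int_minus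
      complex_cnj_one of_real_1 power_one div_by_1)

lemma fourier_coeff_cnj: "fourier_coeff (\<lambda>z. cnj (f z)) n = cnj (fourier_coeff f (- n))"
  unfolding fourier_coeff_eq_mean circle_mean_cnj[symmetric]
  by (rule circle_mean_cong) (simp only: complex_cnj_mult cnj_powi_unit minus_minus)

section \<open>Density of the trigonometric polynomials\<close>

text \<open>
  Only the values on the unit circle are prescribed, so that \<open>Re z\<close> and \<open>Im z\<close>, and with them
  the restrictions of all real polynomials in two variables, are trigonometric.
\<close>

definition trigonometric :: "(complex \<Rightarrow> complex) \<Rightarrow> bool" where
  "trigonometric h \<longleftrightarrow>
     (\<exists>A p. finite A \<and> (\<forall>z. cmod z = 1 \<longrightarrow> h z = (\<Sum>k\<in>A. p k * z powi k)))"

lemma trigonometricI: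
  "finite A \<Longrightarrow> (\<And>z. cmod z = 1 \<Longrightarrow> h z = (\<Sum>k\<in>A. p k * z powi k)) \<Longrightarrow> trigonometric h"
  unfolding trigonometric_def by blast

lemma trigonometric_cong:
  "trigonometric g \<Longrightarrow> (\<And>z. cmod z = 1 \<Longrightarrow> h z = g z) \<Longrightarrow> trigonometric h"
  unfolding trigonometric_def by fastforce

lemma trigonometric_add:
  assumes "trigonometric g" "trigonometric h"
  shows "trigonometric (\<lambda>z. g z + h z)"
proof -
  obtain A p B r where A: "finite A" "\<And>z. cmod z = 1 \<Longrightarrow> g z = (\<Sum>k\<in>A. p k * z powi k)"
    and B: "finite B" "\<And>z. cmod z = 1 \<Longrightarrow> h z = (\<Sum>k\<in>B. r k * z powi k)"
    using assms unfolding trigonometric_def by metis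
  have ext: "(\<Sum>k\<in>D. s k * z powi k) = (\<Sum>k\<in>A \<union> B. (if k \<in> D then s k else 0) * z powi k)"
    if "D \<subseteq> A \<union> B" for D and s :: "int \<Rightarrow> complex" and z :: complex
    using that A(1) B(1) by (intro sum.mono_neutral_cong_left) auto
  show ?thesis
    by (rule trigonometricI[where A = "A \<union> B"
        and p = "\<lambda>k. (if k \<in> A then p k else 0) + (if k \<in> B then r k else 0)"])
      (simp_all only: A B ext[of A] ext[of B] finite_Un Un_upper1 Un_upper2 sum.distrib
        distrib_right simp_thms)
qed

lemma trigonometric_monom_mult:
  assumes "trigonometric h"
  shows "trigonometric (\<lambda>z. c * z powi m * h z)"
proof -
  obtain A p where A: "finite A" "\<And>z. cmod z = 1 \<Longrightarrow> h z = (\<Sum>k\<in>A. p k * z powi k)"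
    using assms unfolding trigonometric_def by metis
  show ?thesis
  proof (rule trigonometricI)
    fix z :: complex assume "cmod z = 1"
    then have "z \<noteq> 0" by auto
    then show "c * z powi m * h z = (\<Sum>k\<in>(\<lambda>k. k + m) ` A. c * p (k - m) * z powi k)"
      using A(2)[OF \<open>cmod z = 1\<close>]
      by (simp add: sum.reindex inj_on_def sum_distrib_left power_int_add mult_ac)
  qed (use A in simp)
qed

lemma trigonometric_const: "trigonometric (\<lambda>z. c)"
  by (rule trigonometricI[where A = "{0}" and p = "\<lambda>_. c"]) simp_all

lemma trigonometric_mult:
  assumes "trigonometric g" "trigonometric h"
  shows "trigonometric (\<lambda>z. g z * h z)"
proof -
  obtain A p where A: "finite A" "\<And>z. cmod z = 1 \<Longrightarrow> g z = (\<Sum>k\<in>A. p k * z powi k)"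
    using assms unfolding trigonometric_def by metis
  have "trigonometric (\<lambda>z. \<Sum>k\<in>A. p k * z powi k * h z)"
    using \<open>finite A\<close>
    by induction (simp_all add: trigonometric_const trigonometric_add
        trigonometric_monom_mult[OF assms(2)])
  then show ?thesis
    by (rule trigonometric_cong) (simp add: A(2) sum_distrib_right)
qed

text \<open>
  A real-linear form on the plane is a combination of \<open>z\<close> and \<open>cnj z\<close>, and \<open>cnj z = z\<^sup>-\<^sup>1\<close> on the
  circle.
\<close>

lemma trigonometric_real_polynomial:
  fixes r :: "complex \<Rightarrow> real"
  assumes "real_polynomial_function r"
  shows "trigonometric (\<lambda>z. of_real (r z))"
  using assms
proof induction
  case (linear r)
  then interpret r: bounded_linear r .
  show ?case
  proof (rule trigonometricI)
    fix z :: complex assume z: "cmod z = 1"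
    have "r z = r (Re z *\<^sub>R 1 + Im z *\<^sub>R \<i>)"
      by (rule arg_cong[of _ _ r]) (simp add: complex_eq_iff)
    also have "\<dots> = Re z * r 1 + Im z * r \<i>"
      by (simp only: r.add r.scaleR real_scaleR_def)
    finally have rz: "r z = Re z * r 1 + Im z * r \<i>" .
    have inv: "z powi -1 = cnj z"
      using cnj_powi_unit[OF z, of 1] by simp
    have "(\<Sum>k\<in>{1, -1}. (r 1 - of_int k * \<i> * r \<i>) / 2 * z powi k) =
        (r 1 - \<i> * r \<i>) / 2 * z + (r 1 + \<i> * r \<i>) / 2 * z powi -1"
      by (simp del: power_int_minus)
    also have "\<dots> = of_real (r z)"
      unfolding inv rz by (rule complex_eqI) (simp_all add: algebra_simps flip: add_divide_distrib)
    finally show "of_real (r z) = (\<Sum>k\<in>{1, -1}. (r 1 - of_int k * \<i> * r \<i>) / 2 * z powi k)"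
      by simp
  qed simp
next
  case (const c)
  show ?case by (rule trigonometric_const)
next
  case (add f g)
  then show ?case by (simp add: trigonometric_add)
next
  case (mult f g)
  then show ?case by (simp add: trigonometric_mult)
qed

lemma trigonometric_polynomial:
  fixes g :: "complex \<Rightarrow> complex"
  assumes "polynomial_function g"
  shows "trigonometric g"
proof -
  have "trigonometric (\<lambda>z. of_real ((Re \<circ> g) z))" "trigonometric (\<lambda>z. of_real ((Im \<circ> g) z))"
    using assms[unfolded polynomial_function_def, rule_format, OF bounded_linear_Re]
      assms[unfolded polynomial_function_def, rule_format, OF bounded_linear_Im]
    by (simp_all only: trigonometric_real_polynomial)
  then have "trigonometric (\<lambda>z. of_real ((Re \<circ> g) z) + \<i> * of_real ((Im \<circ> g) z))"
    by (intro trigonometric_add trigonometric_mult trigonometric_const)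
  then show ?thesis
    by (rule trigonometric_cong) (simp add: complex_eq_iff)
qed

lemma trigonometric_approx_continuous:
  assumes "continuous_on (sphere 0 1) G" "e > 0"
  obtains h where "trigonometric h" "\<And>z. cmod z = 1 \<Longrightarrow> cmod (G z - h z) < e"
proof -
  obtain h where "polynomial_function h" "\<forall>z\<in>sphere 0 1. cmod (G z - h z) < e"
    using Stone_Weierstrass_polynomial_function[OF compact_sphere assms] by blast
  then show thesis
    by (intro that[of h] trigonometric_polynomial) auto
qed

lemma trigonometric_Linf:
  assumes "trigonometric h" shows "h \<in> Linf"
proof -
  obtain A p where A: "\<And>z. cmod z = 1 \<Longrightarrow> h z = (\<Sum>k\<in>A. p k * z powi k)"
    using assms unfolding trigonometric_def by metis
  show ?thesis
    by (rule Linf_cong[OF A]) simp_all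
qed

text \<open>
  A continuous function of the angle need not be continuous on the circle, because \<open>Arg2pi\<close>
  jumps at \<open>1\<close>. For a bounded \<open>k\<close> the factor \<open>min 1 (c |z - 1|)\<close>, which vanishes at \<open>1\<close>,
  repairs this.
\<close>

lemma continuous_on_cutoff_Arg2pi:
  fixes k :: "real \<Rightarrow> complex"
  assumes "continuous_on UNIV k" and bound: "\<And>\<theta>. cmod (k \<theta>) \<le> C"
  shows "continuous_on (sphere 0 1) (\<lambda>z. of_real (min 1 (c * cmod (z - 1))) * k (Arg2pi z))"
  unfolding continuous_on_eq_continuous_within
proof
  fix z :: complex assume "z \<in> sphere 0 1"
  then have "cmod z = 1" by simp
  show "continuous (at z within sphere 0 1)
      (\<lambda>z. of_real (min 1 (c * cmod (z - 1))) * k (Arg2pi z))" (is "continuous _ ?G")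
  proof (cases "z = 1")
    case True
    have "((\<lambda>w. of_real (min 1 (c * cmod (w - 1))) :: complex) \<longlongrightarrow> of_real (min 1 (c * cmod (1 - 1))))
        (at 1 within sphere 0 1)"
      by (intro tendsto_intros)
    then have "((\<lambda>w. of_real (min 1 (c * cmod (w - 1))) :: complex) \<longlongrightarrow> 0) (at 1 within sphere 0 1)"
      by simp
    then have "(?G \<longlongrightarrow> 0) (at 1 within sphere 0 1)"
      by (rule lim_null_mult_right_bounded[where B = C]) (simp add: bound)
    then show ?thesis using True by (simp add: continuous_within)
  next
    case False
    have "z \<notin> \<real>\<^sub>\<ge>\<^sub>0"
      using False \<open>cmod z = 1\<close> by (auto elim!: nonneg_Reals_cases)
    then have "isCont Arg2pi z" by (rule continuous_at_Arg2pi)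
    moreover have "isCont k (Arg2pi z)"
      using assms(1) by (simp add: continuous_on_eq_continuous_at)
    ultimately have "isCont (\<lambda>z. k (Arg2pi z)) z"
      by (rule isCont_o2)
    then have "isCont ?G z"
      by (intro continuous_intros)
    then show ?thesis
      by (rule continuous_at_imp_continuous_at_within)
  qed
qed

text \<open>
  A measurable function of the angle is almost everywhere a limit of continuous ones. They are
  clipped to the disc in which \<open>f\<close> takes almost all its values and multiplied by a cutoff at
  the point \<open>1\<close> that tends to one everywhere else.
\<close>

lemma Linf_AE_limit_continuous:
  assumes f: "f \<in> Linf"
  obtains G C where "\<And>n. continuous_on (sphere 0 1) (G n :: complex \<Rightarrow> complex)"
    "\<And>n z. cmod z = 1 \<Longrightarrow> cmod (G n z) \<le> C"
    "AE \<theta> in circle_measure. (\<lambda>n. G n (cis \<theta>)) \<longlonglongrightarrow> f (cis \<theta>)"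
proof -
  obtain C where "C > 0" and C: "AE \<theta> in circle_measure. cmod (f (cis \<theta>)) \<le> C"
    using Linf_bound[OF f] .
  have "(\<lambda>\<theta>. f (cis \<theta>)) measurable_on {0..2 * pi}"
    using Linf_measurable[OF f] by (subst measurable_on_iff_borel_measurable) auto
  then obtain N g where N: "negligible N" and g: "\<And>n. continuous_on UNIV (g n)"
    and lim: "\<And>\<theta>. \<theta> \<notin> N \<Longrightarrow>
      (\<lambda>n. g n \<theta>) \<longlonglongrightarrow> (if \<theta> \<in> {0..2 * pi} then f (cis \<theta>) else 0)"
    unfolding measurable_on_def by metis
  define k where "k n \<theta> = closest_point (cball 0 C) (g n \<theta>)" for n \<theta>
  have clip: "continuous_on UNIV (closest_point (cball (0::complex) C))"
    using \<open>C > 0\<close> by (intro continuous_on_closest_point) auto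
  have k: "continuous_on UNIV (k n)" for n
    unfolding k_def using continuous_on_compose2[OF clip g] by simp
  have k_le: "cmod (k n \<theta>) \<le> C" for n \<theta>
    using closest_point_in_set[of "cball 0 C" "g n \<theta>"] \<open>C > 0\<close> by (simp add: k_def)
  define G where "G n z = of_real (min 1 (real n * cmod (z - 1))) * k n (Arg2pi z)" for n z
  have "AE \<theta> in lebesgue. \<theta> \<notin> N \<union> {0, 2 * pi}"
    using N by (intro AE_not_in) (simp add: negligible_iff_null_sets[symmetric])
  then have "AE \<theta> in circle_measure. \<theta> \<notin> N \<union> {0, 2 * pi}"
    by (subst AE_restrict_space_iff) (auto elim: eventually_mono)
  moreover have "AE \<theta> in circle_measure. \<theta> \<in> {0..2 * pi}"
    using AE_space[of circle_measure] by simp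
  ultimately have "AE \<theta> in circle_measure. (\<lambda>n. G n (cis \<theta>)) \<longlonglongrightarrow> f (cis \<theta>)"
    using C
  proof eventually_elim
    case (elim \<theta>)
    then have \<theta>: "0 < \<theta>" "\<theta> < 2 * pi" by auto
    then have Arg: "Arg2pi (cis \<theta>) = \<theta>"
      by (intro Arg2pi_unique[of 1]) (auto simp: cis_conv_exp)
    have "cis \<theta> \<noteq> 1"
    proof
      assume "cis \<theta> = 1"
      then show False using \<theta> Arg Arg2pi_of_real[of 1] by simp
    qed
    have "(\<lambda>n. g n \<theta>) \<longlonglongrightarrow> f (cis \<theta>)"
      using lim[of \<theta>] elim by simp
    moreover have "isCont (closest_point (cball 0 C)) (f (cis \<theta>))"
      using clip by (simp add: continuous_on_eq_continuous_at)
    ultimately have "(\<lambda>n. k n \<theta>) \<longlonglongrightarrow> closest_point (cball 0 C) (f (cis \<theta>))"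
      unfolding k_def by (rule isCont_tendsto_compose[rotated])
    then have k_lim: "(\<lambda>n. k n \<theta>) \<longlonglongrightarrow> f (cis \<theta>)"
      using elim by (simp add: closest_point_self)
    have "filterlim (\<lambda>n. real n * cmod (cis \<theta> - 1)) at_top sequentially"
      using \<open>cis \<theta> \<noteq> 1\<close>
      by (intro filterlim_at_top_mult_tendsto_pos[OF tendsto_const]
          filterlim_real_sequentially) auto
    then have "\<forall>\<^sub>F n in sequentially. 1 \<le> real n * cmod (cis \<theta> - 1)"
      by (simp add: filterlim_at_top)
    then have "\<forall>\<^sub>F n in sequentially. k n \<theta> = G n (cis \<theta>)"
      by eventually_elim (simp add: G_def Arg)
    then show ?case by (rule Lim_transform_eventually[OF k_lim])
  qed
  moreover have "cmod (G n z) \<le> C" for n z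
  proof -
    have "cmod (G n z) = \<bar>min 1 (real n * cmod (z - 1))\<bar> * cmod (k n (Arg2pi z))"
      by (simp only: G_def norm_mult norm_of_real)
    also have "\<dots> \<le> 1 * C"
      using k_le by (intro mult_mono) auto
    finally show ?thesis by simp
  qed
  moreover have "continuous_on (sphere 0 1) (G n)" for n
    unfolding G_def by (rule continuous_on_cutoff_Arg2pi[OF k k_le])
  ultimately show thesis using that by blast
qed

text \<open>
  Density in \<open>L\<^sup>2\<close>: each continuous approximant is uniformly close to a trigonometric polynomial
  by the Stone--Weierstrass theorem, and since all these polynomials are bounded by one constant,
  dominated convergence turns almost everywhere convergence into convergence in mean square.
\<close>

lemma trigonometric_dense:
  assumes f: "f \<in> Linf" and "e > 0"
  obtains h where "trigonometric h"
    "Re (circle_mean (\<lambda>z. (f z - h z) * cnj (f z - h z))) < e"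
proof -
  obtain C where "C > 0" and C: "AE \<theta> in circle_measure. cmod (f (cis \<theta>)) \<le> C"
    using Linf_bound[OF f] .
  obtain G D where cont: "\<And>n. continuous_on (sphere 0 1) (G n :: complex \<Rightarrow> complex)"
    and D: "\<And>n z. cmod z = 1 \<Longrightarrow> cmod (G n z) \<le> D"
    and lim: "AE \<theta> in circle_measure. (\<lambda>n. G n (cis \<theta>)) \<longlonglongrightarrow> f (cis \<theta>)"
    by (rule Linf_AE_limit_continuous[OF f]) blast
  have "\<exists>h. trigonometric h \<and> (\<forall>z. cmod z = 1 \<longrightarrow> cmod (G n z - h z) < inverse (real (Suc n)))" for n
    by (rule trigonometric_approx_continuous[OF cont[of n], of "inverse (real (Suc n))"]) auto
  then obtain h where h: "\<And>n. trigonometric (h n)"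
    and Gh: "\<And>n z. cmod z = 1 \<Longrightarrow> cmod (G n z - h n z) < inverse (real (Suc n))"
    by metis
  have h_le: "cmod (h n z) \<le> D + 1" if "cmod z = 1" for n z
  proof -
    have "inverse (real (Suc n)) \<le> 1" by (simp add: field_simps)
    with Gh[OF that, of n] have "cmod (G n z - h n z) \<le> 1" by linarith
    with D[OF that, of n] norm_triangle_sub[of "h n z" "G n z"] show ?thesis
      by (simp add: norm_minus_commute)
  qed
  define r where "r n z = (f z - h n z) * cnj (f z - h n z)" for n z
  have r_Linf: "r n \<in> Linf" for n
    unfolding r_def by (intro Linf_mult Linf_cnj Linf_diff f trigonometric_Linf h)
  have r_eq: "r n z = of_real ((cmod (f z - h n z))\<^sup>2)" for n z
    by (simp only: r_def complex_norm_square)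
  have "(\<lambda>n. LINT \<theta>|circle_measure. r n (cis \<theta>)) \<longlonglongrightarrow> (LINT \<theta>|circle_measure. 0)"
  proof (rule integral_dominated_convergence[where w = "\<lambda>_. (C + (D + 1))\<^sup>2"])
    show "integrable circle_measure (\<lambda>_. (C + (D + 1))\<^sup>2)"
      using finite_measure.integrable_const[OF finite_circle_measure] .
    show "AE \<theta> in circle_measure. (\<lambda>n. r n (cis \<theta>)) \<longlonglongrightarrow> 0"
      using lim
    proof eventually_elim
      case (elim \<theta>)
      have "(\<lambda>n. G n (cis \<theta>) - h n (cis \<theta>)) \<longlonglongrightarrow> 0"
        by (rule Lim_null_comparison[OF _ LIMSEQ_inverse_real_of_nat])
          (use Gh[of "cis \<theta>"] in \<open>simp add: less_imp_le\<close>)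
      from tendsto_diff[OF elim this] have "(\<lambda>n. h n (cis \<theta>)) \<longlonglongrightarrow> f (cis \<theta>)"
        by simp
      then have "(\<lambda>n. r n (cis \<theta>)) \<longlonglongrightarrow> (f (cis \<theta>) - f (cis \<theta>)) * cnj (f (cis \<theta>) - f (cis \<theta>))"
        unfolding r_def by (intro tendsto_intros)
      then show ?case by simp
    qed
    fix n
    show "AE \<theta> in circle_measure. norm (r n (cis \<theta>)) \<le> (C + (D + 1))\<^sup>2"
      using C
    proof eventually_elim
      case (elim \<theta>)
      have "cmod (f (cis \<theta>) - h n (cis \<theta>)) \<le> C + (D + 1)"
        using elim h_le[of "cis \<theta>" n] norm_triangle_ineq4[of "f (cis \<theta>)" "h n (cis \<theta>)"] by simp
      then have "(cmod (f (cis \<theta>) - h n (cis \<theta>)))\<^sup>2 \<le> (C + (D + 1))\<^sup>2"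
        by (rule power_mono) simp
      then show ?case by (simp add: r_eq norm_power)
    qed
  qed (use Linf_measurable[OF r_Linf] in auto)
  then have "(\<lambda>n. Re (circle_mean (r n))) \<longlonglongrightarrow> Re (0 / (2 * pi))"
    unfolding circle_mean_def by (intro tendsto_intros) auto
  then have "\<forall>\<^sub>F n in sequentially. Re (circle_mean (r n)) < e"
    by (rule order_tendstoD) (simp add: \<open>e > 0\<close>)
  then obtain n where "Re (circle_mean (r n)) < e"
    by (auto simp: eventually_sequentially)
  then show thesis
    using that[OF h[of n]] unfolding r_def by simp
qed

section \<open>Fourier coefficients of products\<close>

lemma circle_mean_const: "circle_mean (\<lambda>z. c) = c"
  using circle_mean_cmult[of c "\<lambda>z. z powi 0"] circle_mean_powi[of 0] by simp

lemma circle_mean_mult_cnj_powi: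
  "circle_mean (\<lambda>z. f z * cnj (z powi k)) = fourier_coeff f k"
  unfolding fourier_coeff_eq_mean by (rule circle_mean_cong) (simp only: cnj_powi_unit)

lemma circle_mean_mult_cnj_trig:
  assumes "f \<in> Linf"
  shows "circle_mean (\<lambda>z. f z * cnj (\<Sum>k\<in>A. p k * z powi k)) =
    (\<Sum>k\<in>A. cnj (p k) * fourier_coeff f k)"
proof -
  have "circle_mean (\<lambda>z. f z * cnj (\<Sum>k\<in>A. p k * z powi k)) =
      circle_mean (\<lambda>z. \<Sum>k\<in>A. cnj (p k) * (f z * cnj (z powi k)))"
    by (rule circle_mean_cong) (simp add: sum_distrib_left mult_ac)
  also have "\<dots> = (\<Sum>k\<in>A. circle_mean (\<lambda>z. cnj (p k) * (f z * cnj (z powi k))))"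
    by (intro circle_mean_sum Linf_mult Linf_const Linf_cnj Linf_powi assms)
  finally show ?thesis
    by (simp only: circle_mean_cmult circle_mean_mult_cnj_powi)
qed

lemma fourier_coeff_trig:
  assumes "finite A" "n \<in> A"
  shows "fourier_coeff (\<lambda>z. \<Sum>k\<in>A. p k * z powi k) n = p n"
proof -
  have "fourier_coeff (\<lambda>z. \<Sum>k\<in>A. p k * z powi k) n =
      circle_mean (\<lambda>z. \<Sum>k\<in>A. p k * z powi (k - n))"
    unfolding fourier_coeff_eq_mean
  proof (rule circle_mean_cong)
    fix z :: complex assume "cmod z = 1"
    then have "z \<noteq> 0" by auto
    then have "z powi (k - n) = z powi k * z powi (- n)" for k
      using power_int_add[of z k "- n"] by simp
    then show "(\<Sum>k\<in>A. p k * z powi k) * z powi (- n) = (\<Sum>k\<in>A. p k * z powi (k - n))"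
      by (simp only: sum_distrib_right mult.assoc)
  qed
  also have "\<dots> = (\<Sum>k\<in>A. p k * of_bool (k - n = 0))"
    by (subst circle_mean_sum) (simp_all add: circle_mean_cmult circle_mean_powi)
  also have "\<dots> = (\<Sum>k\<in>A. if k = n then p k else 0)"
    by (rule sum.cong) auto
  also have "\<dots> = p n"
    using assms by simp
  finally show ?thesis .
qed

text \<open>
  Completing the square. The identity shows that among the combinations of the characters in
  \<open>A\<close> the Fourier partial sum is the closest to \<open>f\<close> in mean square.
\<close>

lemma circle_mean_sq_dist_trig:
  assumes "finite A" and f: "f \<in> Linf"
  shows "circle_mean (\<lambda>z. (f z - (\<Sum>k\<in>A. p k * z powi k)) * cnj (f z - (\<Sum>k\<in>A. p k * z powi k))) =
    circle_mean (\<lambda>z. f z * cnj (f z))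
      - of_real (\<Sum>k\<in>A. (cmod (fourier_coeff f k))\<^sup>2)
      + of_real (\<Sum>k\<in>A. (cmod (p k - fourier_coeff f k))\<^sup>2)"
proof -
  define P where "P z = (\<Sum>k\<in>A. p k * z powi k)" for z
  let ?b = "fourier_coeff f"
  have P: "P \<in> Linf" unfolding P_def by simp
  have fP: "circle_mean (\<lambda>z. f z * cnj (P z)) = (\<Sum>k\<in>A. cnj (p k) * ?b k)"
    unfolding P_def by (rule circle_mean_mult_cnj_trig[OF f])
  have "circle_mean (\<lambda>z. P z * cnj (f z)) = cnj (circle_mean (\<lambda>z. f z * cnj (P z)))"
    unfolding circle_mean_cnj[symmetric] by (simp add: mult.commute)
  then have Pf: "circle_mean (\<lambda>z. P z * cnj (f z)) = (\<Sum>k\<in>A. p k * cnj (?b k))"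
    by (simp add: fP)
  have "circle_mean (\<lambda>z. P z * cnj (P z)) = (\<Sum>k\<in>A. cnj (p k) * fourier_coeff P k)"
    using circle_mean_mult_cnj_trig[OF P, of p A] by (simp only: P_def)
  also have "\<dots> = (\<Sum>k\<in>A. cnj (p k) * p k)"
    using fourier_coeff_trig[OF assms(1)] by (intro sum.cong) (simp_all add: P_def[abs_def])
  finally have PP: "circle_mean (\<lambda>z. P z * cnj (P z)) = (\<Sum>k\<in>A. cnj (p k) * p k)" .
  have "circle_mean (\<lambda>z. (f z - P z) * cnj (f z - P z)) =
      circle_mean (\<lambda>z. (f z * cnj (f z) - f z * cnj (P z)) + (P z * cnj (P z) - P z * cnj (f z)))"
    by (rule circle_mean_cong) (simp add: algebra_simps)
  also have "\<dots> = circle_mean (\<lambda>z. f z * cnj (f z)) - (\<Sum>k\<in>A. cnj (p k) * ?b k)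
      + ((\<Sum>k\<in>A. cnj (p k) * p k) - (\<Sum>k\<in>A. p k * cnj (?b k)))"
    using f P by (subst circle_mean_add) (simp_all add: circle_mean_diff fP Pf PP)
  also have "\<dots> = circle_mean (\<lambda>z. f z * cnj (f z))
      + (\<Sum>k\<in>A. - (?b k * cnj (?b k)) + (p k - ?b k) * cnj (p k - ?b k))"
    by (simp add: algebra_simps sum.distrib sum_subtractf sum_negf)
  finally show ?thesis
    by (simp only: P_def of_real_sum complex_norm_square sum.distrib sum_negf) simp
qed

lemma fourier_partial_sum_best_approx:
  fixes p :: "int \<Rightarrow> complex"
  assumes "finite B" "A \<subseteq> B" and f: "f \<in> Linf"
  defines "S \<equiv> \<lambda>z. \<Sum>k\<in>B. fourier_coeff f k * z powi k"
    and "P \<equiv> \<lambda>z. \<Sum>k\<in>A. p k * z powi k"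
  shows "Re (circle_mean (\<lambda>z. (f z - S z) * cnj (f z - S z)))
    \<le> Re (circle_mean (\<lambda>z. (f z - P z) * cnj (f z - P z)))"
proof -
  have "finite A" using assms(1,2) finite_subset by blast
  have "(\<Sum>k\<in>A. (cmod (fourier_coeff f k))\<^sup>2) \<le> (\<Sum>k\<in>B. (cmod (fourier_coeff f k))\<^sup>2)"
    using assms(1,2) by (intro sum_mono2) auto
  moreover have "0 \<le> (\<Sum>k\<in>A. (cmod (p k - fourier_coeff f k))\<^sup>2)"
    by (intro sum_nonneg) auto
  ultimately show ?thesis
    unfolding S_def P_def circle_mean_sq_dist_trig[OF \<open>finite A\<close> f]
      circle_mean_sq_dist_trig[OF \<open>finite B\<close> f] minus_complex.sel plus_complex.sel Re_complex_of_real
    by simp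
qed

text \<open>
  A substitute for the Cauchy--Schwarz inequality: \<open>|g| \<le> \<delta> + |g|\<^sup>2 / \<delta>\<close> holds pointwise.
\<close>

lemma circle_mean_product_small:
  assumes "f \<in> Linf" "g \<in> Linf" "\<delta> > 0"
    and C: "C > 0" "AE \<theta> in circle_measure. cmod (f (cis \<theta>)) \<le> C"
    and small: "Re (circle_mean (\<lambda>z. g z * cnj (g z))) < \<delta>\<^sup>2"
  shows "cmod (circle_mean (\<lambda>z. f z * g z)) < 2 * C * \<delta>"
proof -
  define h where "h z = of_real (C * \<delta>) + of_real (C / \<delta>) * (g z * cnj (g z))" for z
  have h: "h \<in> Linf"
    unfolding h_def by (intro Linf_add Linf_mult Linf_const Linf_cnj assms(2))
  have "cmod (circle_mean (\<lambda>z. f z * g z)) \<le> Re (circle_mean h)"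
  proof (rule norm_circle_mean_le)
    show "AE \<theta> in circle_measure. cmod (f (cis \<theta>) * g (cis \<theta>)) \<le> Re (h (cis \<theta>))"
      using C(2)
    proof eventually_elim
      case (elim \<theta>)
      define t where "t = cmod (g (cis \<theta>))"
      have "t \<ge> 0" by (simp add: t_def)
      have "2 * t * \<delta> \<le> \<delta>\<^sup>2 + t\<^sup>2"
        using sum_squares_bound[of t \<delta>] by simp
      then have "t * \<delta> \<le> \<delta>\<^sup>2 + t\<^sup>2"
        using mult_nonneg_nonneg[OF \<open>t \<ge> 0\<close> less_imp_le[OF \<open>\<delta> > 0\<close>]] by simp
      then have "t \<le> \<delta> + t\<^sup>2 / \<delta>"
        using \<open>\<delta> > 0\<close> by (simp add: field_simps power2_eq_square)
      then have "C * t \<le> C * \<delta> + C / \<delta> * t\<^sup>2"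
        using mult_left_mono[of t "\<delta> + t\<^sup>2 / \<delta>" C] \<open>C > 0\<close> by (simp add: algebra_simps)
      moreover have "cmod (f (cis \<theta>) * g (cis \<theta>)) \<le> C * t"
        unfolding norm_mult t_def[symmetric] using elim \<open>t \<ge> 0\<close> by (rule mult_right_mono)
      moreover have "Re (h (cis \<theta>)) = C * \<delta> + C / \<delta> * t\<^sup>2"
        unfolding h_def complex_norm_square[symmetric] of_real_mult[symmetric] of_real_add[symmetric]
          Re_complex_of_real t_def ..
      ultimately show ?case by linarith
    qed
  qed (use assms h in auto)
  also have "circle_mean h = of_real (C * \<delta>) + of_real (C / \<delta>) * circle_mean (\<lambda>z. g z * cnj (g z))"
  proof -
    have "(\<lambda>z. of_real (C / \<delta>) * (g z * cnj (g z))) \<in> Linf"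
      by (intro Linf_mult Linf_const Linf_cnj assms(2))
    from circle_mean_add[OF Linf_const this] show ?thesis
      by (simp only: h_def[abs_def] circle_mean_const circle_mean_cmult)
  qed
  also have "Re \<dots> = C * \<delta> + C / \<delta> * Re (circle_mean (\<lambda>z. g z * cnj (g z)))"
    by (simp del: of_real_mult of_real_divide)
  also have "\<dots> < C * \<delta> + C / \<delta> * \<delta>\<^sup>2"
    using small C(1) \<open>\<delta> > 0\<close> by (intro add_strict_left_mono mult_strict_left_mono) auto
  also have "\<dots> = 2 * C * \<delta>"
    using \<open>\<delta> > 0\<close> by (simp add: power2_eq_square)
  finally show ?thesis .
qed

text \<open>
  Parseval's identity. Replacing \<open>g\<close> by its partial sum over a finite set \<open>B\<close> of frequencies
  changes the coefficient of \<open>f g\<close> by the mean of a bounded function times the remainder of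
  \<open>g\<close>. The remainder is small in mean square once \<open>B\<close> contains the frequencies of a good
  trigonometric approximation, as the partial sum is then at least as good.
\<close>

theorem has_sum_fourier_coeff_mult:
  assumes f: "f \<in> Linf" and g: "g \<in> Linf"
  shows "((\<lambda>k. fourier_coeff f (n - k) * fourier_coeff g k) has_sum
    fourier_coeff (\<lambda>z. f z * g z) n) UNIV"
  unfolding has_sum_def tendsto_iff eventually_finite_subsets_at_top
proof (intro allI impI)
  fix e :: real assume "e > 0"
  define F where "F z = f z * z powi (- n)" for z
  have F: "F \<in> Linf" unfolding F_def using f by (intro Linf_mult Linf_powi)
  obtain C where C: "C > 0" "AE \<theta> in circle_measure. cmod (F (cis \<theta>)) \<le> C"
    using Linf_bound[OF F] .
  \<comment> \<open>This makes the bound \<open>2 C \<delta>\<close> of \<open>circle_mean_product_small\<close> equal to \<open>e\<close>.\<close>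
  define \<delta> where "\<delta> = e / (2 * C)"
  have \<delta>: "\<delta> > 0" "2 * C * \<delta> = e" using C(1) \<open>e > 0\<close> by (simp_all add: \<delta>_def)
  obtain h where h: "trigonometric h"
    and dist: "Re (circle_mean (\<lambda>z. (g z - h z) * cnj (g z - h z))) < \<delta>\<^sup>2"
    by (rule trigonometric_dense[OF g, of "\<delta>\<^sup>2"]) (use \<delta> in auto)
  obtain A p where A: "finite A" and hA: "\<And>z. cmod z = 1 \<Longrightarrow> h z = (\<Sum>k\<in>A. p k * z powi k)"
    using h unfolding trigonometric_def by metis
  show "\<exists>X. finite X \<and> X \<subseteq> UNIV \<and> (\<forall>Y. finite Y \<and> X \<subseteq> Y \<and> Y \<subseteq> UNIV \<longrightarrow>
      dist (\<Sum>k\<in>Y. fourier_coeff f (n - k) * fourier_coeff g k)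
        (fourier_coeff (\<lambda>z. f z * g z) n) < e)"
  proof (rule exI[of _ A], intro conjI allI impI)
    fix B assume B: "finite B \<and> A \<subseteq> B \<and> B \<subseteq> UNIV"
    define S where "S z = (\<Sum>k\<in>B. fourier_coeff g k * z powi k)" for z
    have S: "S \<in> Linf" unfolding S_def by simp
    have "Re (circle_mean (\<lambda>z. (g z - S z) * cnj (g z - S z)))
        \<le> Re (circle_mean (\<lambda>z. (g z - (\<Sum>k\<in>A. p k * z powi k)) * cnj (g z - (\<Sum>k\<in>A. p k * z powi k))))"
      unfolding S_def using B g by (intro fourier_partial_sum_best_approx) auto
    also have "\<dots> = Re (circle_mean (\<lambda>z. (g z - h z) * cnj (g z - h z)))"
      by (intro arg_cong[of _ _ Re] circle_mean_cong) (simp add: hA)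
    finally have "cmod (circle_mean (\<lambda>z. F z * (g z - S z))) < e"
      using circle_mean_product_small[OF F Linf_diff[OF g S] \<delta>(1) C] dist \<delta>(2) by simp
    moreover have "circle_mean (\<lambda>z. F z * S z) =
        (\<Sum>k\<in>B. fourier_coeff f (n - k) * fourier_coeff g k)"
    proof -
      have "circle_mean (\<lambda>z. F z * S z) =
          circle_mean (\<lambda>z. \<Sum>k\<in>B. fourier_coeff g k * (f z * z powi (- (n - k))))"
      proof (rule circle_mean_cong)
        fix z :: complex assume "cmod z = 1"
        then have "z \<noteq> 0" by auto
        then have "z powi (- (n - k)) = z powi (- n) * z powi k" for k
          using power_int_add[of z "- n" k] by simp
        then show "F z * S z = (\<Sum>k\<in>B. fourier_coeff g k * (f z * z powi (- (n - k))))"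
          by (simp only: F_def S_def sum_distrib_left mult_ac)
      qed
      also have "\<dots> = (\<Sum>k\<in>B. fourier_coeff g k * fourier_coeff f (n - k))"
        unfolding fourier_coeff_eq_mean[of f] circle_mean_cmult[symmetric]
        by (intro circle_mean_sum Linf_mult Linf_const Linf_powi f)
      finally show ?thesis by (simp add: mult.commute)
    qed
    moreover have "circle_mean (\<lambda>z. F z * g z) = fourier_coeff (\<lambda>z. f z * g z) n"
      unfolding fourier_coeff_eq_mean F_def by (simp only: mult_ac)
    moreover have "circle_mean (\<lambda>z. F z * (g z - S z)) =
        circle_mean (\<lambda>z. F z * g z) - circle_mean (\<lambda>z. F z * S z)"
      using F g S by (simp add: right_diff_distrib circle_mean_diff)
    ultimately show "dist (\<Sum>k\<in>B. fourier_coeff f (n - k) * fourier_coeff g k)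
        (fourier_coeff (\<lambda>z. f z * g z) n) < e"
      by (simp add: dist_norm norm_minus_commute)
  qed (use A in auto)
qed

text \<open>
  The Toeplitz form of \<open>f\<close> at \<open>x\<close>, \<open>y\<close> is the mean of \<open>f X cnj Y\<close>, where \<open>X\<close> and \<open>Y\<close> are
  the polynomials with coefficients \<open>x\<close> and \<open>y\<close>; the bound follows from \<open>|X Y| \<le> |X|\<^sup>2 + |Y|\<^sup>2\<close>.
\<close>

lemma Toeplitz_form_bounded:
  assumes f: "f \<in> Linf"
  obtains C where "C > 0"
    "\<And>N (x :: nat \<Rightarrow> complex) y.
       cmod (\<Sum>i\<le>N. \<Sum>j\<le>N. fourier_coeff f (int i - int j) * x j * cnj (y i))
         \<le> C * ((\<Sum>i\<le>N. (cmod (x i))\<^sup>2) + (\<Sum>i\<le>N. (cmod (y i))\<^sup>2))"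
proof -
  obtain C where "C > 0" and C: "AE \<theta> in circle_measure. cmod (f (cis \<theta>)) \<le> C"
    using Linf_bound[OF f] .
  show thesis
  proof (rule that[OF \<open>C > 0\<close>])
    fix N and x y :: "nat \<Rightarrow> complex"
    define X where "X u z = (\<Sum>i\<le>N. u i * z powi (int i))" for u :: "nat \<Rightarrow> complex" and z
    have X: "X u \<in> Linf" for u
      unfolding X_def by (intro Linf_sum Linf_mult Linf_const Linf_powi)
    have XX: "circle_mean (\<lambda>z. X u z * cnj (X u z)) = of_real (\<Sum>i\<le>N. (cmod (u i))\<^sup>2)" for u
    proof -
      have X_int: "X u = (\<lambda>z. \<Sum>k\<in>int ` {..N}. u (nat k) * z powi k)"
        unfolding X_def by (simp add: sum.reindex)
      have "circle_mean (\<lambda>z. X u z * cnj (X u z)) =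
          (\<Sum>k\<in>int ` {..N}. cnj (u (nat k)) * fourier_coeff (X u) k)"
        using circle_mean_mult_cnj_trig[OF X[of u], where A = "int ` {..N}" and p = "\<lambda>k. u (nat k)"]
        by (simp only: X_int)
      also have "\<dots> = (\<Sum>k\<in>int ` {..N}. cnj (u (nat k)) * u (nat k))"
        unfolding X_int by (intro sum.cong refl arg_cong2[of _ _ _ _ "(*)"] fourier_coeff_trig) auto
      also have "\<dots> = (\<Sum>i\<le>N. u i * cnj (u i))"
        by (simp add: sum.reindex mult.commute)
      finally show ?thesis
        by (simp add: complex_norm_square del: of_real_power)
    qed
    define h where "h z = of_real C * (X x z * cnj (X x z) + X y z * cnj (X y z))" for z
    have h: "h \<in> Linf" unfolding h_def using X by simp
    have "(\<Sum>i\<le>N. \<Sum>j\<le>N. fourier_coeff f (int i - int j) * x j * cnj (y i)) =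
        (\<Sum>i\<le>N. \<Sum>j\<le>N. circle_mean (\<lambda>z. x j * cnj (y i) * (f z * z powi (- (int i - int j)))))"
      unfolding fourier_coeff_eq_mean circle_mean_cmult by (simp only: mult_ac)
    also have "\<dots> = circle_mean (\<lambda>z. \<Sum>i\<le>N. \<Sum>j\<le>N.
        x j * cnj (y i) * (f z * z powi (- (int i - int j))))"
      using f by (simp only: circle_mean_sum Linf_sum Linf_mult Linf_const Linf_powi)
    also have "\<dots> = circle_mean (\<lambda>z. f z * (X x z * cnj (X y z)))"
    proof (rule circle_mean_cong)
      fix z :: complex assume z: "cmod z = 1"
      then have "z \<noteq> 0" by auto
      then have "z powi (- (int i - int j)) = cnj (z powi int i) * z powi int j" for i j
        using power_int_add[of z "- int i" "int j"] cnj_powi_unit[OF z, of "int i"] by simp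
      then show "(\<Sum>i\<le>N. \<Sum>j\<le>N. x j * cnj (y i) * (f z * z powi (- (int i - int j)))) =
          f z * (X x z * cnj (X y z))"
        unfolding X_def cnj_sum sum_product
        by (subst sum.swap) (simp only: sum_distrib_left complex_cnj_mult mult_ac)
    qed
    also have "cmod \<dots> \<le> Re (circle_mean h)"
    proof (rule norm_circle_mean_le)
      show "AE \<theta> in circle_measure.
          cmod (f (cis \<theta>) * (X x (cis \<theta>) * cnj (X y (cis \<theta>)))) \<le> Re (h (cis \<theta>))"
        using C
      proof eventually_elim
        case (elim \<theta>)
        define s t where "s = cmod (X x (cis \<theta>))" and "t = cmod (X y (cis \<theta>))"
        have "cmod (f (cis \<theta>) * (X x (cis \<theta>) * cnj (X y (cis \<theta>)))) = cmod (f (cis \<theta>)) * (s * t)"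
          by (simp add: norm_mult s_def t_def)
        also have "\<dots> \<le> C * (s\<^sup>2 + t\<^sup>2)"
        proof (rule mult_mono)
          have "0 \<le> s * t" by (simp add: s_def t_def)
          then show "s * t \<le> s\<^sup>2 + t\<^sup>2" using sum_squares_bound[of s t] by simp
        qed (use elim \<open>C > 0\<close> in \<open>simp_all add: s_def t_def\<close>)
        also have "\<dots> = Re (h (cis \<theta>))"
          unfolding h_def complex_norm_square[symmetric] of_real_add[symmetric]
            of_real_mult[symmetric] Re_complex_of_real s_def t_def ..
        finally show ?case .
      qed
    qed (use f X h in auto)
    also have "circle_mean h = of_real (C * ((\<Sum>i\<le>N. (cmod (x i))\<^sup>2) + (\<Sum>i\<le>N. (cmod (y i))\<^sup>2)))"
      unfolding h_def circle_mean_cmult using X by (subst circle_mean_add) (simp_all add: XX)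
    finally show "cmod (\<Sum>i\<le>N. \<Sum>j\<le>N. fourier_coeff f (int i - int j) * x j * cnj (y i))
        \<le> C * ((\<Sum>i\<le>N. (cmod (x i))\<^sup>2) + (\<Sum>i\<le>N. (cmod (y i))\<^sup>2))"
      by (simp only: Re_complex_of_real)
  qed
qed

section \<open>Bounded operators and their kernels\<close>

lemma ell2_summable: "x \<in> ell2 q \<Longrightarrow> (\<lambda>\<sigma>. (cmod (x \<sigma>))\<^sup>2) summable_on tree q"
  by (simp add: ell2_def)

lemma ell2_outside: "x \<in> ell2 q \<Longrightarrow> \<sigma> \<notin> tree q \<Longrightarrow> x \<sigma> = 0"
  by (simp add: ell2_def)

lemma ell2_norm_nonneg: "0 \<le> ell2_norm q x"
  by (simp add: ell2_norm_def infsum_nonneg)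

lemma ell2_norm_sq: "(ell2_norm q x)\<^sup>2 = (\<Sum>\<^sub>\<infinity>\<sigma>\<in>tree q. (cmod (x \<sigma>))\<^sup>2)"
  by (simp add: ell2_norm_def infsum_nonneg)

lemma sum_le_ell2_norm:
  assumes "x \<in> ell2 q" "finite F" "F \<subseteq> tree q"
  shows "(\<Sum>\<sigma>\<in>F. (cmod (x \<sigma>))\<^sup>2) \<le> (ell2_norm q x)\<^sup>2"
  unfolding ell2_norm_sq using assms by (intro finite_sum_le_infsum ell2_summable) auto

lemma norm_le_ell2_norm:
  assumes "x \<in> ell2 q" "\<sigma> \<in> tree q"
  shows "cmod (x \<sigma>) \<le> ell2_norm q x"
  using sum_le_ell2_norm[of x q "{\<sigma>}"] assms
  by (intro power2_le_imp_le[OF _ ell2_norm_nonneg]) auto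

lemma ell2_restrict:
  assumes "x \<in> ell2 q"
  shows "(\<lambda>\<sigma>. if \<sigma> \<in> G then x \<sigma> else 0) \<in> ell2 q"
proof -
  have "(\<lambda>\<sigma>. (cmod (if \<sigma> \<in> G then x \<sigma> else 0))\<^sup>2) summable_on tree q"
    by (rule summable_on_comparison_test[OF ell2_summable[OF assms]]) auto
  then show ?thesis using ell2_outside[OF assms] by (auto simp: ell2_def)
qed

lemma ell2_add:
  assumes x: "x \<in> ell2 q" and y: "y \<in> ell2 q"
  shows "(\<lambda>\<sigma>. x \<sigma> + y \<sigma>) \<in> ell2 q"
proof -
  have "(\<lambda>\<sigma>. (cmod (x \<sigma> + y \<sigma>))\<^sup>2) summable_on tree q"
  proof (rule summable_on_comparison_test)
    show "(\<lambda>\<sigma>. 2 * (cmod (x \<sigma>))\<^sup>2 + 2 * (cmod (y \<sigma>))\<^sup>2) summable_on tree q"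
      by (intro summable_on_add summable_on_cmult_right ell2_summable x y)
    fix \<sigma>
    have "(cmod (x \<sigma> + y \<sigma>))\<^sup>2 \<le> (cmod (x \<sigma>) + cmod (y \<sigma>))\<^sup>2"
      by (intro power_mono norm_triangle_ineq) auto
    also have "\<dots> \<le> 2 * (cmod (x \<sigma>))\<^sup>2 + 2 * (cmod (y \<sigma>))\<^sup>2"
      using sum_squares_bound[of "cmod (x \<sigma>)" "cmod (y \<sigma>)"] by (simp add: power2_sum)
    finally show "(cmod (x \<sigma> + y \<sigma>))\<^sup>2 \<le> 2 * (cmod (x \<sigma>))\<^sup>2 + 2 * (cmod (y \<sigma>))\<^sup>2" .
  qed auto
  then show ?thesis using x y by (auto simp: ell2_def)
qed

lemma ell2_cmult: "x \<in> ell2 q \<Longrightarrow> (\<lambda>\<sigma>. c * x \<sigma>) \<in> ell2 q"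
  by (auto simp: ell2_def norm_mult power_mult_distrib intro: summable_on_cmult_right)

lemma delta_ell2: "\<tau> \<in> tree q \<Longrightarrow> delta \<tau> \<in> ell2 q"
proof -
  assume \<tau>: "\<tau> \<in> tree q"
  have "(\<lambda>\<sigma>. (cmod (delta \<tau> \<sigma>))\<^sup>2) summable_on tree q \<longleftrightarrow>
      (\<lambda>\<sigma>. (cmod (delta \<tau> \<sigma>))\<^sup>2) summable_on {\<tau>}"
    using \<tau> by (intro summable_on_cong_neutral) (auto simp: delta_def)
  then show ?thesis using \<tau> by (auto simp: ell2_def delta_def)
qed

lemma infsum_single_support:
  fixes f :: "'a \<Rightarrow> complex"
  assumes "a \<in> S" "\<And>b. b \<in> S \<Longrightarrow> b \<noteq> a \<Longrightarrow> f b = 0"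
  shows "infsum f S = f a"
proof -
  have "infsum f S = infsum f {a}"
    using assms by (intro infsum_cong_neutral) auto
  then show ?thesis by simp
qed

lemma kernel_of_eq: "\<sigma> \<in> tree q \<Longrightarrow> kernel_of q A \<sigma> \<tau> = A (delta \<tau>) \<sigma>"
  unfolding kernel_of_def ell2_inner_def
  by (subst infsum_single_support[of \<sigma>]) (auto simp: delta_def)

lemma bounded_operator_ell2: "A \<in> bounded_operators q \<Longrightarrow> x \<in> ell2 q \<Longrightarrow> A x \<in> ell2 q"
  by (auto simp: bounded_operators_def)

lemma bounded_operator_add:
  "A \<in> bounded_operators q \<Longrightarrow> x \<in> ell2 q \<Longrightarrow> y \<in> ell2 q \<Longrightarrow>
    A (\<lambda>\<sigma>. x \<sigma> + y \<sigma>) = (\<lambda>\<sigma>. A x \<sigma> + A y \<sigma>)"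
  by (auto simp: bounded_operators_def)

lemma bounded_operator_cmult:
  "A \<in> bounded_operators q \<Longrightarrow> x \<in> ell2 q \<Longrightarrow> A (\<lambda>\<sigma>. c * x \<sigma>) = (\<lambda>\<sigma>. c * A x \<sigma>)"
  by (auto simp: bounded_operators_def)

lemma bounded_operator_bound:
  assumes "A \<in> bounded_operators q"
  obtains C where "C > 0" "\<And>x. x \<in> ell2 q \<Longrightarrow> ell2_norm q (A x) \<le> C * ell2_norm q x"
proof -
  obtain C where C: "\<And>x. x \<in> ell2 q \<Longrightarrow> ell2_norm q (A x) \<le> C * ell2_norm q x"
    using assms unfolding bounded_operators_def by blast
  have "ell2_norm q (A x) \<le> max C 1 * ell2_norm q x" if "x \<in> ell2 q" for x
    using C[OF that] mult_right_mono[OF max.cobounded1 ell2_norm_nonneg, of C q x 1] by linarith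
  moreover have "0 < max C 1" by (rule less_le_trans[OF zero_less_one max.cobounded2])
  ultimately show thesis by (rule that[rotated])
qed

lemma bounded_operator_finite_support:
  assumes A: "A \<in> bounded_operators q" and x: "x \<in> ell2 q" and "finite G" "G \<subseteq> tree q"
  shows "A (\<lambda>\<sigma>. if \<sigma> \<in> G then x \<sigma> else 0) \<sigma> = (\<Sum>\<tau>\<in>G. A (delta \<tau>) \<sigma> * x \<tau>)"
  using \<open>finite G\<close> \<open>G \<subseteq> tree q\<close>
proof induction
  case empty
  show ?case using bounded_operator_cmult[OF A x, of 0] by (auto dest: fun_cong)
next
  case (insert \<tau> G)
  then have "\<tau> \<in> tree q" by simp
  have cdelta: "(\<lambda>\<sigma>. x \<tau> * delta \<tau> \<sigma>) \<in> ell2 q"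
  proof -
    have "(\<lambda>\<sigma>. x \<tau> * delta \<tau> \<sigma>) = (\<lambda>\<sigma>. if \<sigma> \<in> {\<tau>} then x \<sigma> else 0)"
      by (auto simp: delta_def)
    then show ?thesis using ell2_restrict[OF x, of "{\<tau>}"] by simp
  qed
  have "(\<lambda>\<sigma>. if \<sigma> \<in> insert \<tau> G then x \<sigma> else 0) =
      (\<lambda>\<sigma>. (if \<sigma> \<in> G then x \<sigma> else 0) + x \<tau> * delta \<tau> \<sigma>)"
    using insert.hyps by (auto simp: delta_def)
  then show ?case
    using insert bounded_operator_add[OF A ell2_restrict[OF x, of G] cdelta]
      bounded_operator_cmult[OF A delta_ell2[OF \<open>\<tau> \<in> tree q\<close>], of "x \<tau>"]
    by (simp add: add.commute mult.commute)
qed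

text \<open>
  A bounded operator acts as a matrix: on the restriction of \<open>x\<close> to a finite set this is
  linearity, and the rest of \<open>x\<close> has small norm.
\<close>

proposition bounded_operator_has_sum:
  assumes A: "A \<in> bounded_operators q" and x: "x \<in> ell2 q" and \<sigma>: "\<sigma> \<in> tree q"
  shows "((\<lambda>\<tau>. kernel_of q A \<sigma> \<tau> * x \<tau>) has_sum A x \<sigma>) (tree q)"
  unfolding has_sum_def tendsto_iff
proof (intro allI impI)
  fix e :: real assume "e > 0"
  obtain C where "C > 0" and C: "\<And>x. x \<in> ell2 q \<Longrightarrow> ell2_norm q (A x) \<le> C * ell2_norm q x"
    using bounded_operator_bound[OF A] by blast
  have "((\<lambda>\<sigma>. (cmod (x \<sigma>))\<^sup>2) has_sum (ell2_norm q x)\<^sup>2) (tree q)"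
    unfolding ell2_norm_sq by (rule has_sum_infsum[OF ell2_summable[OF x]])
  then have "\<forall>\<^sub>F G in finite_subsets_at_top (tree q).
      dist (\<Sum>\<sigma>\<in>G. (cmod (x \<sigma>))\<^sup>2) ((ell2_norm q x)\<^sup>2) < (e / C)\<^sup>2"
    unfolding has_sum_def by (rule tendstoD) (use \<open>e > 0\<close> \<open>C > 0\<close> in simp)
  moreover have "\<forall>\<^sub>F G in finite_subsets_at_top (tree q). finite G \<and> G \<subseteq> tree q"
    by (rule eventually_finite_subsets_at_top_weakI) auto
  ultimately show "\<forall>\<^sub>F G in finite_subsets_at_top (tree q).
      dist (\<Sum>\<tau>\<in>G. kernel_of q A \<sigma> \<tau> * x \<tau>) (A x \<sigma>) < e"
  proof eventually_elim
    case (elim G)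
    define y where "y \<sigma> = (if \<sigma> \<in> - G then x \<sigma> else 0)" for \<sigma>
    have y: "y \<in> ell2 q" unfolding y_def by (rule ell2_restrict[OF x])
    have "(\<lambda>\<sigma>. (if \<sigma> \<in> G then x \<sigma> else 0) + y \<sigma>) = x"
      by (auto simp: y_def)
    then have "A x \<sigma> = (\<Sum>\<tau>\<in>G. kernel_of q A \<sigma> \<tau> * x \<tau>) + A y \<sigma>"
      using bounded_operator_add[OF A ell2_restrict[OF x, of G] y]
        bounded_operator_finite_support[OF A x, of G] elim
      by (simp add: kernel_of_eq[OF \<sigma>])
    moreover have "cmod (A y \<sigma>) < e"
    proof -
      have "(ell2_norm q y)\<^sup>2 = (\<Sum>\<^sub>\<infinity>\<sigma>\<in>tree q - G. (cmod (x \<sigma>))\<^sup>2)"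
        unfolding ell2_norm_sq y_def by (rule infsum_cong_neutral) auto
      also have "\<dots> = (ell2_norm q x)\<^sup>2 - (\<Sum>\<sigma>\<in>G. (cmod (x \<sigma>))\<^sup>2)"
        unfolding ell2_norm_sq using elim by (subst infsum_Diff) (auto intro: ell2_summable[OF x])
      also have "\<dots> < (e / C)\<^sup>2"
        using elim by (auto simp: dist_real_def)
      finally have "ell2_norm q y < e / C"
        using \<open>e > 0\<close> \<open>C > 0\<close> by (intro power2_less_imp_less[of _ "e / C"]) auto
      then have "C * ell2_norm q y < e"
        using \<open>C > 0\<close> by (simp add: field_simps)
      with C[OF y] norm_le_ell2_norm[OF bounded_operator_ell2[OF A y] \<sigma>] show ?thesis
        by linarith
    qed
    ultimately show ?case by (simp add: dist_norm)
  qed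
qed

corollary bounded_operator_eqI:
  assumes A: "A \<in> bounded_operators q" and B: "B \<in> bounded_operators q"
    and eq: "\<And>\<sigma> \<tau>. \<sigma> \<in> tree q \<Longrightarrow> \<tau> \<in> tree q \<Longrightarrow> kernel_of q A \<sigma> \<tau> = kernel_of q B \<sigma> \<tau>"
  shows "A = B"
proof (rule PiE_ext)
  show "A \<in> ell2 q \<rightarrow>\<^sub>E ell2 q" "B \<in> ell2 q \<rightarrow>\<^sub>E ell2 q"
    using A B by (auto simp: bounded_operators_def)
  fix x assume x: "x \<in> ell2 q"
  show "A x = B x"
  proof
    fix \<sigma>
    show "A x \<sigma> = B x \<sigma>"
    proof (cases "\<sigma> \<in> tree q")
      case True
      have "((\<lambda>\<tau>. kernel_of q A \<sigma> \<tau> * x \<tau>) has_sum B x \<sigma>) (tree q)"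
        using bounded_operator_has_sum[OF B x True]
        by (rule has_sum_cong[THEN iffD1, rotated]) (simp add: eq True)
      then show ?thesis
        by (rule has_sum_unique[OF bounded_operator_has_sum[OF A x True]])
    next
      case False
      then show ?thesis
        using ell2_outside bounded_operator_ell2[OF A x] bounded_operator_ell2[OF B x] by metis
    qed
  qed
qed

lemma operator_of_kernel_eqI:
  assumes "A \<in> bounded_operators q"
    and "\<And>\<sigma> \<tau>. \<sigma> \<in> tree q \<Longrightarrow> \<tau> \<in> tree q \<Longrightarrow> kernel_of q A \<sigma> \<tau> = K \<sigma> \<tau>"
  shows "operator_of_kernel q K = A"
  unfolding operator_of_kernel_def
  using assms by (intro the_equality) (auto intro!: bounded_operator_eqI)

lemma compose_bounded_operators:
  assumes A: "A \<in> bounded_operators q" and B: "B \<in> bounded_operators q"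
  shows "compose (ell2 q) A B \<in> bounded_operators q"
proof -
  obtain C where C: "C > 0" "\<And>x. x \<in> ell2 q \<Longrightarrow> ell2_norm q (A x) \<le> C * ell2_norm q x"
    using bounded_operator_bound[OF A] by blast
  obtain D where D: "\<And>x. x \<in> ell2 q \<Longrightarrow> ell2_norm q (B x) \<le> D * ell2_norm q x"
    using bounded_operator_bound[OF B] by blast
  have bound: "ell2_norm q (A (B x)) \<le> C * D * ell2_norm q x" if "x \<in> ell2 q" for x
  proof -
    have "ell2_norm q (A (B x)) \<le> C * ell2_norm q (B x)"
      by (rule C(2)[OF bounded_operator_ell2[OF B that]])
    also have "\<dots> \<le> C * (D * ell2_norm q x)"
      using D[OF that] C(1) by simp
    finally show ?thesis by (simp add: mult.assoc)
  qed
  show ?thesis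
    unfolding bounded_operators_def
  proof (intro CollectI conjI ballI allI)
    show "compose (ell2 q) A B \<in> ell2 q \<rightarrow>\<^sub>E ell2 q"
      using bounded_operator_ell2[OF A] bounded_operator_ell2[OF B]
      by (auto simp: compose_def)
    show "\<exists>C. \<forall>x\<in>ell2 q. ell2_norm q (compose (ell2 q) A B x) \<le> C * ell2_norm q x"
      using bound by (auto simp: compose_eq)
  qed (use bounded_operator_ell2[OF B] in \<open>simp_all add: compose_eq ell2_add ell2_cmult
      bounded_operator_add[OF A] bounded_operator_add[OF B]
      bounded_operator_cmult[OF A] bounded_operator_cmult[OF B]\<close>)
qed

lemma kernel_of_compose_has_sum:
  assumes A: "A \<in> bounded_operators q" and B: "B \<in> bounded_operators q"
    and \<sigma>: "\<sigma> \<in> tree q" and \<tau>: "\<tau> \<in> tree q"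
  shows "((\<lambda>\<omega>. kernel_of q A \<sigma> \<omega> * kernel_of q B \<omega> \<tau>) has_sum
    kernel_of q (compose (ell2 q) A B) \<sigma> \<tau>) (tree q)"
proof -
  have sum: "((\<lambda>\<omega>. kernel_of q A \<sigma> \<omega> * B (delta \<tau>) \<omega>) has_sum A (B (delta \<tau>)) \<sigma>) (tree q)"
    by (intro bounded_operator_has_sum A \<sigma> bounded_operator_ell2[OF B] delta_ell2 \<tau>)
  have eq: "kernel_of q (compose (ell2 q) A B) \<sigma> \<tau> = A (B (delta \<tau>)) \<sigma>"
    using delta_ell2[OF \<tau>] by (simp add: kernel_of_eq[OF \<sigma>] compose_eq)
  show ?thesis
    unfolding eq by (rule has_sum_cong[THEN iffD1, OF _ sum]) (simp add: kernel_of_eq)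
qed

text \<open>
  A matrix whose finite square sections are uniformly bounded defines a bounded operator. Testing
  a section against its own conjugated row shows that the rows are square summable, so the matrix
  can be applied to every vector, and the bound passes to the limit.
\<close>

proposition bounded_operator_of_bounded_sections:
  assumes "C \<ge> 0"
    and K: "\<And>F x. finite F \<Longrightarrow> F \<subseteq> tree q \<Longrightarrow>
      (\<Sum>\<sigma>\<in>F. (cmod (\<Sum>\<tau>\<in>F. K \<sigma> \<tau> * x \<tau>))\<^sup>2) \<le> C\<^sup>2 * (\<Sum>\<tau>\<in>F. (cmod (x \<tau>))\<^sup>2)"
  obtains A where "A \<in> bounded_operators q"
    "\<And>\<sigma> \<tau>. \<sigma> \<in> tree q \<Longrightarrow> \<tau> \<in> tree q \<Longrightarrow> kernel_of q A \<sigma> \<tau> = K \<sigma> \<tau>"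
proof -
  have sections: "(\<Sum>\<sigma>\<in>F. (cmod (\<Sum>\<tau>\<in>G. K \<sigma> \<tau> * x \<tau>))\<^sup>2) \<le> C\<^sup>2 * (\<Sum>\<tau>\<in>G. (cmod (x \<tau>))\<^sup>2)"
    if F: "finite F" "F \<subseteq> tree q" and G: "finite G" "G \<subseteq> tree q" for F G x
  proof -
    let ?y = "\<lambda>\<tau>. if \<tau> \<in> G then x \<tau> else 0"
    have "(\<Sum>\<tau>\<in>F \<union> G. K \<sigma> \<tau> * ?y \<tau>) = (\<Sum>\<tau>\<in>G. K \<sigma> \<tau> * x \<tau>)" for \<sigma>
      using F G by (intro sum.mono_neutral_cong_right) auto
    moreover have "(\<Sum>\<tau>\<in>F \<union> G. (cmod (?y \<tau>))\<^sup>2) = (\<Sum>\<tau>\<in>G. (cmod (x \<tau>))\<^sup>2)"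
      using F G by (intro sum.mono_neutral_cong_right) auto
    ultimately have "(\<Sum>\<sigma>\<in>F \<union> G. (cmod (\<Sum>\<tau>\<in>G. K \<sigma> \<tau> * x \<tau>))\<^sup>2) \<le> C\<^sup>2 * (\<Sum>\<tau>\<in>G. (cmod (x \<tau>))\<^sup>2)"
      using K[of "F \<union> G" ?y] F G by simp
    moreover have "(\<Sum>\<sigma>\<in>F. (cmod (\<Sum>\<tau>\<in>G. K \<sigma> \<tau> * x \<tau>))\<^sup>2)
        \<le> (\<Sum>\<sigma>\<in>F \<union> G. (cmod (\<Sum>\<tau>\<in>G. K \<sigma> \<tau> * x \<tau>))\<^sup>2)"
      using F G by (intro sum_mono2) auto
    ultimately show ?thesis by linarith
  qed
  have row_bound: "(\<Sum>\<tau>\<in>G. (cmod (K \<sigma> \<tau>))\<^sup>2) \<le> C\<^sup>2"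
    if "\<sigma> \<in> tree q" and G: "finite G" "G \<subseteq> tree q" for \<sigma> G
  proof -
    define S where "S = (\<Sum>\<tau>\<in>G. (cmod (K \<sigma> \<tau>))\<^sup>2)"
    have "S \<ge> 0" unfolding S_def by (intro sum_nonneg) auto
    have "(\<Sum>\<tau>\<in>G. K \<sigma> \<tau> * cnj (K \<sigma> \<tau>)) = of_real S"
      by (simp add: S_def complex_norm_square del: of_real_power)
    then have "S\<^sup>2 \<le> C\<^sup>2 * S"
      using sections[of "{\<sigma>}" G "\<lambda>\<tau>. cnj (K \<sigma> \<tau>)"] that \<open>S \<ge> 0\<close>
      by (simp only: S_def[symmetric] sum.insert sum.empty finite.intros empty_iff simp_thms
          complex_mod_cnj norm_of_real abs_of_nonneg power2_abs add_0_right) simp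
    then show ?thesis
      unfolding S_def[symmetric] using \<open>S \<ge> 0\<close>
      by (cases "S = 0") (simp_all add: power2_eq_square)
  qed
  have row: "(\<lambda>\<tau>. (cmod (K \<sigma> \<tau>))\<^sup>2) summable_on tree q" if "\<sigma> \<in> tree q" for \<sigma>
    using row_bound[OF that]
    by (intro nonneg_bdd_above_summable_on bdd_aboveI2[where M = "C\<^sup>2"]) auto
  have summable: "(\<lambda>\<tau>. K \<sigma> \<tau> * x \<tau>) summable_on tree q" if "\<sigma> \<in> tree q" "x \<in> ell2 q" for \<sigma> x
  proof (rule abs_summable_summable, rule Infinite_Sum.abs_summable_on_comparison_test')
    show "(\<lambda>\<tau>. (cmod (K \<sigma> \<tau>))\<^sup>2 + (cmod (x \<tau>))\<^sup>2) summable_on tree q"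
      by (intro summable_on_add row ell2_summable that)
    show "cmod (K \<sigma> \<tau> * x \<tau>) \<le> (cmod (K \<sigma> \<tau>))\<^sup>2 + (cmod (x \<tau>))\<^sup>2" for \<tau>
    proof -
      have "0 \<le> cmod (K \<sigma> \<tau>) * cmod (x \<tau>)" by simp
      then show ?thesis
        using sum_squares_bound[of "cmod (K \<sigma> \<tau>)" "cmod (x \<tau>)"]
        unfolding norm_mult mult.assoc by linarith
    qed
  qed
  define T where "T x \<sigma> = (if \<sigma> \<in> tree q then \<Sum>\<^sub>\<infinity>\<tau>\<in>tree q. K \<sigma> \<tau> * x \<tau> else 0)" for x \<sigma>
  have T_bound: "(\<Sum>\<sigma>\<in>F. (cmod (T x \<sigma>))\<^sup>2) \<le> C\<^sup>2 * (ell2_norm q x)\<^sup>2"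
    if x: "x \<in> ell2 q" and F: "finite F" "F \<subseteq> tree q" for F x
  proof (rule tendsto_upperbound)
    show "((\<lambda>G. \<Sum>\<sigma>\<in>F. (cmod (\<Sum>\<tau>\<in>G. K \<sigma> \<tau> * x \<tau>))\<^sup>2) \<longlongrightarrow> (\<Sum>\<sigma>\<in>F. (cmod (T x \<sigma>))\<^sup>2))
        (finite_subsets_at_top (tree q))"
    proof (intro tendsto_sum tendsto_power tendsto_norm)
      fix \<sigma> assume "\<sigma> \<in> F"
      then have "\<sigma> \<in> tree q" using F by blast
      then show "((\<lambda>G. \<Sum>\<tau>\<in>G. K \<sigma> \<tau> * x \<tau>) \<longlongrightarrow> T x \<sigma>) (finite_subsets_at_top (tree q))"
        using has_sum_infsum[OF summable[OF _ x]] by (simp add: T_def has_sum_def)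
    qed
    show "\<forall>\<^sub>F G in finite_subsets_at_top (tree q).
        (\<Sum>\<sigma>\<in>F. (cmod (\<Sum>\<tau>\<in>G. K \<sigma> \<tau> * x \<tau>))\<^sup>2) \<le> C\<^sup>2 * (ell2_norm q x)\<^sup>2"
    proof (rule eventually_finite_subsets_at_top_weakI)
      fix G assume G: "finite G" "G \<subseteq> tree q"
      show "(\<Sum>\<sigma>\<in>F. (cmod (\<Sum>\<tau>\<in>G. K \<sigma> \<tau> * x \<tau>))\<^sup>2) \<le> C\<^sup>2 * (ell2_norm q x)\<^sup>2"
        using sections[OF F G, of x] mult_left_mono[OF sum_le_ell2_norm[OF x G], of "C\<^sup>2"] by simp
    qed
  qed simp
  have T_ell2: "T x \<in> ell2 q" if "x \<in> ell2 q" for x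
  proof -
    have "(\<lambda>\<sigma>. (cmod (T x \<sigma>))\<^sup>2) summable_on tree q"
      using T_bound[OF that]
      by (intro nonneg_bdd_above_summable_on bdd_aboveI2[where M = "C\<^sup>2 * (ell2_norm q x)\<^sup>2"]) auto
    then show ?thesis by (simp add: ell2_def T_def)
  qed
  have T_norm: "ell2_norm q (T x) \<le> C * ell2_norm q x" if "x \<in> ell2 q" for x
  proof (rule power2_le_imp_le)
    show "(ell2_norm q (T x))\<^sup>2 \<le> (C * ell2_norm q x)\<^sup>2"
      unfolding ell2_norm_sq[of q "T x"] power_mult_distrib
      by (intro infsum_le_finite_sums ell2_summable T_ell2 that T_bound)
  qed (use \<open>C \<ge> 0\<close> ell2_norm_nonneg in auto)
  have T_add: "T (\<lambda>\<tau>. x \<tau> + y \<tau>) = (\<lambda>\<sigma>. T x \<sigma> + T y \<sigma>)" if "x \<in> ell2 q" "y \<in> ell2 q" for x y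
    using that by (auto simp: T_def distrib_left infsum_add summable)
  have T_cmult: "T (\<lambda>\<tau>. c * x \<tau>) = (\<lambda>\<sigma>. c * T x \<sigma>)" for c x
    by (auto simp: T_def mult.left_commute infsum_cmult_right')
  define A where "A = restrict T (ell2 q)"
  have "A \<in> bounded_operators q"
    unfolding bounded_operators_def
  proof (intro CollectI conjI ballI allI)
    show "\<exists>C. \<forall>x\<in>ell2 q. ell2_norm q (A x) \<le> C * ell2_norm q x"
      using T_norm by (auto simp: A_def)
  qed (use T_ell2 in \<open>auto simp: A_def ell2_add ell2_cmult T_add T_cmult\<close>)
  moreover have "kernel_of q A \<sigma> \<tau> = K \<sigma> \<tau>" if "\<sigma> \<in> tree q" "\<tau> \<in> tree q" for \<sigma> \<tau>
  proof -
    have "(\<Sum>\<^sub>\<infinity>\<omega>\<in>tree q. K \<sigma> \<omega> * delta \<tau> \<omega>) = K \<sigma> \<tau>"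
      using that by (subst infsum_single_support[of \<tau>]) (auto simp: delta_def)
    then show ?thesis
      using that by (simp add: kernel_of_eq A_def delta_ell2 T_def)
  qed
  ultimately show thesis using that by blast
qed

section \<open>Toeplitz kernels on the tree\<close>

text \<open>
  The kernel of \<open>\<Gamma>\<^sub>q\<close> for an arbitrary coefficient sequence. Since subtraction of natural numbers
  is truncated, the exponent is the distance \<open>| |\<sigma>| - |\<tau>| |\<close> of comparable vertices.
\<close>

definition tree_Toeplitz :: "nat \<Rightarrow> (int \<Rightarrow> complex) \<Rightarrow> vertex \<Rightarrow> vertex \<Rightarrow> complex" where
  "tree_Toeplitz q a \<sigma> \<tau> =
     (if prefix \<sigma> \<tau> \<or> prefix \<tau> \<sigma>
      then of_real ((1 / sqrt q) ^ ((length \<sigma> - length \<tau>) + (length \<tau> - length \<sigma>))) *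
        a (int (length \<sigma>) - int (length \<tau>))
      else 0)"

lemma tree_append: "\<sigma> @ \<tau> \<in> tree q \<longleftrightarrow> \<sigma> \<in> tree q \<and> \<tau> \<in> tree q"
  by (auto simp: tree_def)

lemma Gamma_kernel_eq_tree_Toeplitz:
  assumes "q > 0" "\<sigma> \<in> tree q" "\<tau> \<in> tree q"
  shows "Gamma_kernel q f \<sigma> \<tau> = tree_Toeplitz q (fourier_coeff f) \<sigma> \<tau>"
proof -
  have pow: "real q powr (- (real n / 2)) = (1 / sqrt q) ^ n" for n
  proof -
    have "1 / sqrt q = real q powr (- (1 / 2))"
      using assms(1) by (simp add: powr_minus powr_half_sqrt inverse_eq_divide)
    then have "(1 / sqrt q) ^ n = (real q powr (- (1 / 2))) powr real n"
      using assms(1) by (simp add: powr_realpow)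
    then show ?thesis by (simp add: powr_powr)
  qed
  have "tree_dist q \<sigma> \<tau> = (length \<sigma> - length \<tau>) + (length \<tau> - length \<sigma>)"
    if "prefix \<sigma> \<tau> \<or> prefix \<tau> \<sigma>"
    using that assms(2,3) tree_dist_append tree_dist_commute[of q \<sigma> \<tau>]
    by (auto simp: prefix_def)
  then show ?thesis
    unfolding Gamma_kernel_def tree_Toeplitz_def comparable_def pow
    using assms by (simp add: tree_le_iff_prefix level_eq_length)
qed

lemma tree_Toeplitz_transpose:
  "tree_Toeplitz q a \<sigma> \<tau> = tree_Toeplitz q (\<lambda>k. a (- k)) \<tau> \<sigma>"
  by (auto simp: tree_Toeplitz_def add.commute)

section \<open>Averaging over the boundary\<close>

definition words :: "nat \<Rightarrow> nat \<Rightarrow> vertex set" where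
  "words q n = {\<omega> \<in> tree q. length \<omega> = n}"

lemma words_eq: "words q n = {xs. set xs \<subseteq> {..<q} \<and> length xs = n}"
  by (auto simp: words_def tree_def lists_eq_set)

lemma finite_words [simp]: "finite (words q n)"
  unfolding words_eq by (rule finite_lists_length_eq) simp

lemma card_words: "card (words q n) = q ^ n"
  unfolding words_eq by (subst card_lists_length_eq) simp_all

lemma card_words_prefix:
  assumes "\<sigma> \<in> tree q" "length \<sigma> \<le> n"
  shows "card {\<omega> \<in> words q n. prefix \<sigma> \<omega>} = q ^ (n - length \<sigma>)"
proof -
  have "{\<omega> \<in> words q n. prefix \<sigma> \<omega>} = (@) \<sigma> ` words q (n - length \<sigma>)"
    using assms by (auto simp: words_def prefix_def tree_append image_iff)
  then show ?thesis by (simp add: card_image inj_on_def card_words)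
qed

text \<open>
  The words of length \<open>n\<close> approximate the boundary of the tree. With the uniform probability
  measure on them, \<open>\<sigma>\<close> corresponds to the normalised indicator of the words below \<open>\<sigma>\<close>; the
  factor \<open>q\<^sup>-\<^sup>n\<^sup>/\<^sup>2\<close> absorbs the measure.
\<close>

definition boundary_vector :: "nat \<Rightarrow> nat \<Rightarrow> vertex \<Rightarrow> vertex \<Rightarrow> real" where
  "boundary_vector q n \<sigma> \<omega> = (if prefix \<sigma> \<omega> then sqrt q ^ length \<sigma> / sqrt q ^ n else 0)"

lemma boundary_vector_Gram_prefix:
  assumes "q > 0" "\<tau> \<in> tree q" "length \<tau> \<le> n" "prefix \<sigma> \<tau>"
  shows "(\<Sum>\<omega>\<in>words q n. boundary_vector q n \<sigma> \<omega> * boundary_vector q n \<tau> \<omega>) =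
    (1 / sqrt q) ^ (length \<tau> - length \<sigma>)"
proof -
  define s where "s = sqrt q"
  have s: "s > 0" "real q = s\<^sup>2" using assms(1) by (simp_all add: s_def)
  obtain d m where d: "length \<tau> = length \<sigma> + d" and m: "n = length \<tau> + m"
    using assms(3) prefix_length_le[OF assms(4)] le_Suc_ex by metis
  have "(\<Sum>\<omega>\<in>words q n. boundary_vector q n \<sigma> \<omega> * boundary_vector q n \<tau> \<omega>) =
      (\<Sum>\<omega>\<in>{\<omega> \<in> words q n. prefix \<tau> \<omega>}. s ^ length \<sigma> / s ^ n * (s ^ length \<tau> / s ^ n))"
    using assms(4) prefix_order.trans
    by (intro sum.mono_neutral_cong_right) (auto simp: boundary_vector_def s_def)
  also have "\<dots> = real q ^ m * (s ^ length \<sigma> / s ^ n * (s ^ length \<tau> / s ^ n))"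
    using card_words_prefix[OF assms(2,3)] m by simp
  also have "\<dots> = (1 / s) ^ d"
    unfolding s(2) m d using s(1) by (simp add: field_simps power_add power2_eq_square power_mult_distrib)
  finally show ?thesis using d by (simp add: s_def)
qed

text \<open>
  The Gram matrix of the boundary vectors is the factor \<open>q\<^sup>-\<^sup>d\<^sup>/\<^sup>2\<close>, restricted to comparable pairs,
  in the kernel of \<open>\<Gamma>\<^sub>q\<close>.
\<close>

lemma boundary_vector_Gram:
  assumes "q > 0" "\<sigma> \<in> tree q" "\<tau> \<in> tree q" "length \<sigma> \<le> n" "length \<tau> \<le> n"
  shows "of_real (\<Sum>\<omega>\<in>words q n. boundary_vector q n \<sigma> \<omega> * boundary_vector q n \<tau> \<omega>) *
      a (int (length \<sigma>) - int (length \<tau>)) = tree_Toeplitz q a \<sigma> \<tau>"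
proof -
  consider "prefix \<sigma> \<tau>" | "prefix \<tau> \<sigma>" | "\<not> prefix \<sigma> \<tau>" "\<not> prefix \<tau> \<sigma>" by blast
  then show ?thesis
  proof cases
    case 1
    then show ?thesis
      using boundary_vector_Gram_prefix[OF assms(1,3,5) 1] prefix_length_le[OF 1]
      by (simp add: tree_Toeplitz_def)
  next
    case 2
    then show ?thesis
      using boundary_vector_Gram_prefix[OF assms(1,2,4) 2] prefix_length_le[OF 2]
      by (simp add: tree_Toeplitz_def mult.commute)
  next
    case 3
    then have "boundary_vector q n \<sigma> \<omega> * boundary_vector q n \<tau> \<omega> = 0" for \<omega>
      using prefix_same_cases[of \<sigma> \<omega> \<tau>] by (auto simp: boundary_vector_def)
    then have "(\<Sum>\<omega>\<in>words q n. boundary_vector q n \<sigma> \<omega> * boundary_vector q n \<tau> \<omega>) = 0"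
      by (intro sum.neutral) simp
    then show ?thesis using 3 by (simp only: tree_Toeplitz_def) simp
  qed
qed

lemma sum_over_prefixes:
  fixes h :: "vertex \<Rightarrow> 'a::comm_monoid_add"
  assumes "finite F" "\<And>\<sigma>. \<sigma> \<in> F \<Longrightarrow> \<not> prefix \<sigma> \<omega> \<Longrightarrow> h \<sigma> = 0"
  shows "(\<Sum>\<sigma>\<in>F. h \<sigma>) = (\<Sum>i\<le>length \<omega>. if take i \<omega> \<in> F then h (take i \<omega>) else 0)"
proof -
  have "(\<Sum>\<sigma>\<in>F. h \<sigma>) = (\<Sum>\<sigma>\<in>{\<sigma> \<in> F. prefix \<sigma> \<omega>}. h \<sigma>)"
    using assms by (intro sum.mono_neutral_right) auto
  also have "\<dots> = (\<Sum>i\<in>{i \<in> {..length \<omega>}. take i \<omega> \<in> F}. h (take i \<omega>))"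
    by (rule sum.reindex_bij_witness[where i = "\<lambda>i. take i \<omega>" and j = length])
      (auto simp: take_is_prefix min_def prefix_length_le elim: prefixE)
  also have "\<dots> = (\<Sum>i\<le>length \<omega>. if take i \<omega> \<in> F then h (take i \<omega>) else 0)"
    by (rule sum.inter_filter) simp
  finally show ?thesis .
qed

text \<open>
  By the Gram identity the form splits into a sum over the words \<open>\<omega>\<close> of a fixed length. For
  fixed \<open>\<omega>\<close> only the prefixes of \<open>\<omega>\<close> contribute, one on each level, so the summand is the value
  of an ordinary Toeplitz form. The bounds add up without loss, because the boundary vectors have
  norm one.
\<close>

proposition tree_Toeplitz_form_bounded:
  assumes "q > 0"
    and bound: "\<And>N (x :: nat \<Rightarrow> complex) y.
      cmod (\<Sum>i\<le>N. \<Sum>j\<le>N. a (int i - int j) * x j * cnj (y i))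
        \<le> C * ((\<Sum>i\<le>N. (cmod (x i))\<^sup>2) + (\<Sum>i\<le>N. (cmod (y i))\<^sup>2))"
    and F: "finite F" "F \<subseteq> tree q"
  shows "cmod (\<Sum>\<sigma>\<in>F. \<Sum>\<tau>\<in>F. tree_Toeplitz q a \<sigma> \<tau> * x \<tau> * cnj (y \<sigma>))
    \<le> C * ((\<Sum>\<sigma>\<in>F. (cmod (x \<sigma>))\<^sup>2) + (\<Sum>\<sigma>\<in>F. (cmod (y \<sigma>))\<^sup>2))"
proof -
  \<comment> \<open>Zero is inserted because \<open>F\<close> may be empty.\<close>
  define N where "N = Max (insert 0 (length ` F))"
  have N: "length \<sigma> \<le> N" if "\<sigma> \<in> F" for \<sigma>
    unfolding N_def using that F(1) by (intro Max_ge) auto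
  let ?v = "boundary_vector q N"
  define w where "w x \<omega> \<sigma> = of_real (?v \<sigma> \<omega>) * x \<sigma>" for x :: "vertex \<Rightarrow> complex" and \<omega> \<sigma>
  have w0: "w x \<omega> \<sigma> = 0" if "\<not> prefix \<sigma> \<omega>" for x \<omega> \<sigma>
    using that by (simp add: w_def boundary_vector_def)
  define X where "X x \<omega> i = (if take i \<omega> \<in> F then w x \<omega> (take i \<omega>) else 0)"
    for x :: "vertex \<Rightarrow> complex" and \<omega> i
  have form: "(\<Sum>\<sigma>\<in>F. \<Sum>\<tau>\<in>F. a (int (length \<sigma>) - int (length \<tau>)) * w x \<omega> \<tau> * cnj (w y \<omega> \<sigma>)) =
      (\<Sum>i\<le>N. \<Sum>j\<le>N. a (int i - int j) * X x \<omega> j * cnj (X y \<omega> i))" if "length \<omega> = N" for \<omega>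
  proof -
    have inner: "(\<Sum>\<tau>\<in>F. a (k - int (length \<tau>)) * w x \<omega> \<tau> * c) =
        (\<Sum>j\<le>N. a (k - int j) * X x \<omega> j * c)" for k c
      by (subst sum_over_prefixes[where \<omega> = \<omega>])
        (use F(1) that in \<open>auto simp: w0 X_def min_def intro!: sum.cong\<close>)
    show ?thesis unfolding inner
      by (subst sum_over_prefixes[where \<omega> = \<omega>])
        (use F(1) that in \<open>auto simp: w0 X_def min_def intro!: sum.cong\<close>)
  qed
  have sq: "(\<Sum>i\<le>N. (cmod (X x \<omega> i))\<^sup>2) = (\<Sum>\<sigma>\<in>F. (?v \<sigma> \<omega>)\<^sup>2 * (cmod (x \<sigma>))\<^sup>2)"
    if "length \<omega> = N" for x \<omega>
    by (subst sum_over_prefixes[where \<omega> = \<omega>])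
      (use F(1) that in \<open>auto simp: boundary_vector_def X_def w_def norm_mult power_mult_distrib
        intro!: sum.cong\<close>)
  have unit: "(\<Sum>\<omega>\<in>words q N. \<Sum>\<sigma>\<in>F. (?v \<sigma> \<omega>)\<^sup>2 * (cmod (x \<sigma>))\<^sup>2) = (\<Sum>\<sigma>\<in>F. (cmod (x \<sigma>))\<^sup>2)" for x
  proof -
    have "(\<Sum>\<omega>\<in>words q N. (?v \<sigma> \<omega>)\<^sup>2) = 1" if "\<sigma> \<in> F" for \<sigma>
      using boundary_vector_Gram_prefix[of q \<sigma> N \<sigma>] assms(1) F(2) N[OF that] that
      by (auto simp: power2_eq_square)
    then show ?thesis
      by (subst sum.swap) (simp add: sum_distrib_right[symmetric])
  qed
  have "(\<Sum>\<sigma>\<in>F. \<Sum>\<tau>\<in>F. tree_Toeplitz q a \<sigma> \<tau> * x \<tau> * cnj (y \<sigma>)) =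
      (\<Sum>\<sigma>\<in>F. \<Sum>\<tau>\<in>F. \<Sum>\<omega>\<in>words q N.
        a (int (length \<sigma>) - int (length \<tau>)) * w x \<omega> \<tau> * cnj (w y \<omega> \<sigma>))"
  proof (intro sum.cong refl)
    fix \<sigma> \<tau> assume \<sigma>\<tau>: "\<sigma> \<in> F" "\<tau> \<in> F"
    then have "tree_Toeplitz q a \<sigma> \<tau> = of_real (\<Sum>\<omega>\<in>words q N. ?v \<sigma> \<omega> * ?v \<tau> \<omega>) *
        a (int (length \<sigma>) - int (length \<tau>))"
      using F(2) N assms(1) by (subst boundary_vector_Gram) auto
    then show "tree_Toeplitz q a \<sigma> \<tau> * x \<tau> * cnj (y \<sigma>) = (\<Sum>\<omega>\<in>words q N.
        a (int (length \<sigma>) - int (length \<tau>)) * w x \<omega> \<tau> * cnj (w y \<omega> \<sigma>))"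
      by (simp add: w_def sum_distrib_left sum_distrib_right mult_ac)
  qed
  also have "\<dots> = (\<Sum>\<sigma>\<in>F. \<Sum>\<omega>\<in>words q N. \<Sum>\<tau>\<in>F.
        a (int (length \<sigma>) - int (length \<tau>)) * w x \<omega> \<tau> * cnj (w y \<omega> \<sigma>))"
    by (intro sum.cong refl sum.swap)
  also have "\<dots> = (\<Sum>\<omega>\<in>words q N. \<Sum>\<sigma>\<in>F. \<Sum>\<tau>\<in>F.
        a (int (length \<sigma>) - int (length \<tau>)) * w x \<omega> \<tau> * cnj (w y \<omega> \<sigma>))"
    by (rule sum.swap)
  also have "\<dots> = (\<Sum>\<omega>\<in>words q N.
      \<Sum>i\<le>N. \<Sum>j\<le>N. a (int i - int j) * X x \<omega> j * cnj (X y \<omega> i))"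
    by (intro sum.cong refl form) (simp add: words_def)
  also have "cmod \<dots> \<le> (\<Sum>\<omega>\<in>words q N. C * ((\<Sum>i\<le>N. (cmod (X x \<omega> i))\<^sup>2) + (\<Sum>i\<le>N. (cmod (X y \<omega> i))\<^sup>2)))"
    by (intro sum_norm_le bound)
  also have "\<dots> = (\<Sum>\<omega>\<in>words q N. C * ((\<Sum>\<sigma>\<in>F. (?v \<sigma> \<omega>)\<^sup>2 * (cmod (x \<sigma>))\<^sup>2) +
      (\<Sum>\<sigma>\<in>F. (?v \<sigma> \<omega>)\<^sup>2 * (cmod (y \<sigma>))\<^sup>2)))"
    by (intro sum.cong refl) (simp add: sq words_def)
  also have "\<dots> = C * ((\<Sum>\<sigma>\<in>F. (cmod (x \<sigma>))\<^sup>2) + (\<Sum>\<sigma>\<in>F. (cmod (y \<sigma>))\<^sup>2))"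
    unfolding sum_distrib_left[symmetric] sum.distrib unit ..
  finally show ?thesis .
qed

text \<open>
  Duality: a form bound, tested with a multiple of the image vector, bounds the image.
\<close>

lemma sections_bounded_of_form:
  fixes K :: "'a \<Rightarrow> 'a \<Rightarrow> complex"
  assumes "C > 0"
    and form: "\<And>x y. cmod (\<Sum>\<sigma>\<in>F. \<Sum>\<tau>\<in>F. K \<sigma> \<tau> * x \<tau> * cnj (y \<sigma>))
      \<le> C * ((\<Sum>\<sigma>\<in>F. (cmod (x \<sigma>))\<^sup>2) + (\<Sum>\<sigma>\<in>F. (cmod (y \<sigma>))\<^sup>2))"
  shows "(\<Sum>\<sigma>\<in>F. (cmod (\<Sum>\<tau>\<in>F. K \<sigma> \<tau> * x \<tau>))\<^sup>2) \<le> (2 * C)\<^sup>2 * (\<Sum>\<tau>\<in>F. (cmod (x \<tau>))\<^sup>2)"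
proof -
  define w where "w \<sigma> = (\<Sum>\<tau>\<in>F. K \<sigma> \<tau> * x \<tau>)" for \<sigma>
  define W where "W = (\<Sum>\<sigma>\<in>F. (cmod (w \<sigma>))\<^sup>2)"
  have "W \<ge> 0" unfolding W_def by (intro sum_nonneg) auto
  \<comment> \<open>The factor minimises \<open>C (\<parallel>x\<parallel>\<^sup>2 + t\<^sup>2 W) - t W\<close> over \<open>t\<close>.\<close>
  define y where "y \<sigma> = of_real (1 / (2 * C)) * w \<sigma>" for \<sigma>
  have "(\<Sum>\<sigma>\<in>F. \<Sum>\<tau>\<in>F. K \<sigma> \<tau> * x \<tau> * cnj (y \<sigma>)) = (\<Sum>\<sigma>\<in>F. w \<sigma> * cnj (y \<sigma>))"
    by (simp only: w_def sum_distrib_right)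
  also have "\<dots> = of_real (1 / (2 * C)) * (\<Sum>\<sigma>\<in>F. w \<sigma> * cnj (w \<sigma>))"
    unfolding y_def sum_distrib_left complex_cnj_mult complex_cnj_complex_of_real
    by (simp only: mult_ac)
  also have "\<dots> = of_real (W / (2 * C))"
    unfolding W_def complex_norm_square[symmetric] by simp
  finally have lhs: "cmod (\<Sum>\<sigma>\<in>F. \<Sum>\<tau>\<in>F. K \<sigma> \<tau> * x \<tau> * cnj (y \<sigma>)) = W / (2 * C)"
    using \<open>C > 0\<close> \<open>W \<ge> 0\<close> by (simp only: norm_of_real) simp
  have "(\<Sum>\<sigma>\<in>F. (cmod (y \<sigma>))\<^sup>2) = W / (2 * C)\<^sup>2"
    unfolding y_def W_def norm_mult norm_of_real power_mult_distrib sum_distrib_left[symmetric]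
    using \<open>C > 0\<close> by (simp add: power2_eq_square)
  then have "W / (2 * C) \<le> C * ((\<Sum>\<tau>\<in>F. (cmod (x \<tau>))\<^sup>2) + W / (2 * C)\<^sup>2)"
    using form[of x y] lhs by simp
  then have "W \<le> (2 * C)\<^sup>2 * (\<Sum>\<tau>\<in>F. (cmod (x \<tau>))\<^sup>2)"
    using \<open>C > 0\<close> by (simp add: field_simps power2_eq_square)
  then show ?thesis by (simp add: W_def w_def)
qed

proposition Gamma_op_bounded:
  assumes "q > 0" "f \<in> Linf"
  shows "Gamma_op q f \<in> bounded_operators q"
    and "\<And>\<sigma> \<tau>. \<sigma> \<in> tree q \<Longrightarrow> \<tau> \<in> tree q \<Longrightarrow>
      kernel_of q (Gamma_op q f) \<sigma> \<tau> = tree_Toeplitz q (fourier_coeff f) \<sigma> \<tau>"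
proof -
  obtain C where C: "C > 0" "\<And>N (x :: nat \<Rightarrow> complex) y.
       cmod (\<Sum>i\<le>N. \<Sum>j\<le>N. fourier_coeff f (int i - int j) * x j * cnj (y i))
         \<le> C * ((\<Sum>i\<le>N. (cmod (x i))\<^sup>2) + (\<Sum>i\<le>N. (cmod (y i))\<^sup>2))"
    by (rule Toeplitz_form_bounded[OF assms(2)]) blast
  obtain A where A: "A \<in> bounded_operators q"
    and kernel: "\<And>\<sigma> \<tau>. \<sigma> \<in> tree q \<Longrightarrow> \<tau> \<in> tree q \<Longrightarrow>
      kernel_of q A \<sigma> \<tau> = tree_Toeplitz q (fourier_coeff f) \<sigma> \<tau>"
  proof (rule bounded_operator_of_bounded_sections)
    fix F :: "vertex set" and x assume "finite F" "F \<subseteq> tree q"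
    then show "(\<Sum>\<sigma>\<in>F. (cmod (\<Sum>\<tau>\<in>F. tree_Toeplitz q (fourier_coeff f) \<sigma> \<tau> * x \<tau>))\<^sup>2)
        \<le> (2 * C)\<^sup>2 * (\<Sum>\<tau>\<in>F. (cmod (x \<tau>))\<^sup>2)"
      by (intro sections_bounded_of_form tree_Toeplitz_form_bounded assms(1) C)
  qed (use C(1) in auto)
  have "Gamma_op q f = A"
    unfolding Gamma_op_def
    by (rule operator_of_kernel_eqI[OF A]) (simp add: kernel Gamma_kernel_eq_tree_Toeplitz assms(1))
  then show "Gamma_op q f \<in> bounded_operators q"
    and "\<And>\<sigma> \<tau>. \<sigma> \<in> tree q \<Longrightarrow> \<tau> \<in> tree q \<Longrightarrow>
      kernel_of q (Gamma_op q f) \<sigma> \<tau> = tree_Toeplitz q (fourier_coeff f) \<sigma> \<tau>"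
    using A kernel by auto
qed

section \<open>Products of Toeplitz kernels\<close>

text \<open>
  There are \<open>q\<^sup>m\<close> words of length \<open>m\<close>, which the weight \<open>q\<^sup>-\<^sup>m\<close> compensates.
\<close>

lemma has_sum_tree_radial:
  fixes h :: "nat \<Rightarrow> complex"
  assumes "q > 0" and h: "(\<lambda>m. norm (h m)) summable_on UNIV"
  shows "((\<lambda>\<rho>. of_real ((1 / real q) ^ length \<rho>) * h (length \<rho>)) has_sum (\<Sum>\<^sub>\<infinity>m. h m)) (tree q)"
proof -
  define F where "F = (\<lambda>(m :: nat, \<rho> :: vertex). complex_of_real ((1 / real q) ^ length \<rho>) * h (length \<rho>))"
  have mean: "(\<Sum>\<rho>\<in>words q m. (1 / real q) ^ length \<rho> * c) = c" for m and c :: real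
  proof -
    have "(\<Sum>\<rho>\<in>words q m. (1 / real q) ^ length \<rho> * c) = (\<Sum>\<rho>\<in>words q m. (1 / real q) ^ m * c)"
      by (rule sum.cong) (auto simp: words_def)
    then show ?thesis using assms(1) by (simp add: card_words power_divide)
  qed
  have inner: "((\<lambda>\<rho>. F (m, \<rho>)) has_sum h m) (words q m)" for m
  proof (rule has_sum_finiteI)
    have "(\<Sum>\<rho>\<in>words q m. F (m, \<rho>)) = (\<Sum>\<rho>\<in>words q m. of_real ((1 / real q) ^ length \<rho>) * h m)"
      by (rule sum.cong) (auto simp: F_def words_def)
    also have "\<dots> = of_real (\<Sum>\<rho>\<in>words q m. (1 / real q) ^ length \<rho>) * h m"
      by (simp only: sum_distrib_right of_real_sum)
    also have "(\<Sum>\<rho>\<in>words q m. (1 / real q) ^ length \<rho>) = 1"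
      using mean[of 1 m] by (simp only: mult_1_right)
    also have "of_real 1 * h m = h m" by simp
    finally show "h m = (\<Sum>\<rho>\<in>words q m. F (m, \<rho>))" by simp
  qed simp
  have inner_norm: "(\<Sum>\<rho>\<in>words q m. norm (F (m, \<rho>))) = norm (h m)" for m
  proof -
    have "(\<Sum>\<rho>\<in>words q m. norm (F (m, \<rho>))) = (\<Sum>\<rho>\<in>words q m. (1 / real q) ^ length \<rho> * norm (h m))"
      by (rule sum.cong) (simp_all add: F_def words_def norm_mult del: of_real_power of_real_divide)
    then show ?thesis by (simp only: mean)
  qed
  have norms: "(\<Sum>\<^sub>\<infinity>\<rho>\<in>words q m. norm (F (m, \<rho>))) = norm (h m)" for m
    using inner_norm[of m] by (simp only: infsum_finite finite_words)
  have "(\<lambda>x. norm (F x)) summable_on Sigma UNIV (words q)"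
    unfolding Infinite_Sum.abs_summable_on_Sigma_iff norms real_norm_def abs_norm_cancel
    using h by (auto intro: summable_on_finite)
  then have "F summable_on Sigma UNIV (words q)"
    by (rule abs_summable_summable)
  then have "(F has_sum (\<Sum>\<^sub>\<infinity>m. h m)) (Sigma UNIV (words q))"
    by (rule has_sum_SigmaI[OF inner has_sum_infsum[OF abs_summable_summable[OF h]]])
  then have "((\<lambda>x. of_real ((1 / real q) ^ length (snd x)) * h (length (snd x))) has_sum
      (\<Sum>\<^sub>\<infinity>m. h m)) (Sigma UNIV (words q))"
    by (simp only: F_def case_prod_unfold)
  moreover have "bij_betw snd (Sigma UNIV (words q)) (tree q)"
    by (rule bij_betw_byWitness[where f' = "\<lambda>\<rho>. (length \<rho>, \<rho>)"]) (auto simp: words_def)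
  ultimately show ?thesis
    using has_sum_reindex_bij_betw[of snd "Sigma UNIV (words q)" "tree q"
        "\<lambda>\<rho>. of_real ((1 / real q) ^ length \<rho>) * h (length \<rho>)"] by blast
qed

lemma tree_take: "\<sigma> \<in> tree q \<Longrightarrow> take k \<sigma> \<in> tree q"
  by (auto simp: tree_def lists_eq_set dest: in_set_takeD)

text \<open>
  A vertex \<open>\<omega>\<close> contributes only if it is comparable with \<open>u @ r\<close>. It then lies strictly above
  \<open>u\<close> (\<open>S1\<close>), on the path from \<open>u\<close> to \<open>u @ r\<close> without its endpoint (\<open>S2\<close>), or in the subtree
  below \<open>u @ r\<close> (\<open>S3\<close>). Going up by \<open>m\<close> levels and coming back costs the factor \<open>q\<^sup>-\<^sup>m\<close>; in the
  subtree the same factor is cancelled by the number of vertices. Hence \<open>S2\<close> and \<open>S3\<close> together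
  give the Toeplitz sum over \<open>k \<ge> 0\<close>, while \<open>S1\<close> gives a correction that depends on the depth
  of \<open>u\<close>.
\<close>

proposition tree_Toeplitz_product_below:
  assumes "q > 0" "u @ r \<in> tree q"
    and summable: "(\<lambda>k. norm (a (int (length r) - k) * b k)) summable_on UNIV"
  shows "((\<lambda>\<omega>. tree_Toeplitz q a (u @ r) \<omega> * tree_Toeplitz q b \<omega> u) has_sum
    of_real ((1 / sqrt q) ^ length r) *
      ((\<Sum>m = 1..length u. of_real ((1 / real q) ^ m) * (a (int (length r + m)) * b (- int m))) +
       (\<Sum>\<^sub>\<infinity>k\<in>{0..}. a (int (length r) - k) * b k))) (tree q)"
proof -
  define n where "n = length r"
  define t where "t = 1 / sqrt q"
  have tt: "t ^ m * t ^ m = (1 / real q) ^ m" for m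
    using assms(1) by (simp add: t_def flip: power_mult_distrib)
  define c where "c k = a (int n - k) * b k" for k
  define G where "G \<omega> = tree_Toeplitz q a (u @ r) \<omega> * tree_Toeplitz q b \<omega> u" for \<omega>
  define T where "T = complex_of_real (t ^ n)"
  define S1 where "S1 = (\<lambda>m. take (length u - m) u) ` {1..length u}"
  define S2 where "S2 = (\<lambda>k. u @ take k r) ` {..<n}"
  define S3 where "S3 = (\<lambda>\<rho>. u @ r @ \<rho>) ` tree q"
  have c_summable: "(\<lambda>k. norm (c k)) summable_on A" for A
    using summable_on_subset_banach[OF summable subset_UNIV] by (simp add: c_def[abs_def] n_def)
  have G1: "(G has_sum T * (\<Sum>m = 1..length u.
      of_real ((1 / real q) ^ m) * (a (int (length r + m)) * b (- int m)))) S1"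
  proof (rule has_sum_finiteI)
    have "sum G S1 = (\<Sum>m = 1..length u. G (take (length u - m) u))"
      unfolding S1_def
    proof (rule sum.reindex_cong[OF _ refl refl])
      show "inj_on (\<lambda>m. take (length u - m) u) {1..length u}"
        by (rule inj_on_inverseI[where g = "\<lambda>\<sigma>. length u - length \<sigma>"]) auto
    qed
    also have "\<dots> = (\<Sum>m = 1..length u.
        T * (of_real ((1 / real q) ^ m) * (a (int (length r + m)) * b (- int m))))"
    proof (rule sum.cong[OF refl])
      fix m assume m: "m \<in> {1..length u}"
      let ?\<omega> = "take (length u - m) u"
      have "prefix ?\<omega> u" by (rule take_is_prefix)
      then have "prefix ?\<omega> (u @ r)" by (rule prefix_prefix)
      then have "G ?\<omega> = of_real (t ^ (n + m)) * a (int (n + m)) * (of_real (t ^ m) * b (- int m))"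
        using m \<open>prefix ?\<omega> u\<close> unfolding G_def tree_Toeplitz_def t_def[symmetric]
        by (simp add: n_def of_nat_diff add.commute)
      also have "\<dots> = T * (of_real (t ^ m * t ^ m) * (a (int (n + m)) * b (- int m)))"
        by (simp add: T_def power_add)
      finally show "G ?\<omega> = T * (of_real ((1 / real q) ^ m) * (a (int (length r + m)) * b (- int m)))"
        by (simp only: tt n_def)
    qed
    finally show "T * (\<Sum>m = 1..length u.
        of_real ((1 / real q) ^ m) * (a (int (length r + m)) * b (- int m))) = sum G S1"
      by (simp only: sum_distrib_left)
  qed (simp add: S1_def)
  have G2: "(G has_sum T * (\<Sum>\<^sub>\<infinity>k\<in>{0..<int n}. c k)) S2"
  proof (rule has_sum_finiteI)
    have "sum G S2 = (\<Sum>k<n. G (u @ take k r))"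
      unfolding S2_def
    proof (rule sum.reindex_cong[OF _ refl refl])
      show "inj_on (\<lambda>k. u @ take k r) {..<n}"
        by (rule inj_on_inverseI[where g = "\<lambda>\<sigma>. length \<sigma> - length u"]) (auto simp: n_def)
    qed
    also have "\<dots> = (\<Sum>k<n. T * c (int k))"
    proof (rule sum.cong[OF refl])
      fix k assume k: "k \<in> {..<n}"
      let ?\<omega> = "u @ take k r"
      have "prefix ?\<omega> (u @ r)" by (simp add: take_is_prefix)
      moreover have "prefix u ?\<omega>" by simp
      ultimately have "G ?\<omega> = of_real (t ^ (n - k)) * a (int n - int k) * (of_real (t ^ k) * b (int k))"
        using k unfolding G_def tree_Toeplitz_def t_def[symmetric]
        by (simp add: n_def)
      also have "\<dots> = of_real (t ^ (n - k) * t ^ k) * c (int k)"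
        by (simp add: c_def)
      also have "t ^ (n - k) * t ^ k = t ^ n"
        using k by (simp add: power_add[symmetric] del: power_Suc)
      finally show "G ?\<omega> = T * c (int k)" by (simp only: T_def)
    qed
    also have "\<dots> = T * (\<Sum>k<n. c (int k))"
      by (simp only: sum_distrib_left)
    also have "(\<Sum>k<n. c (int k)) = (\<Sum>k\<in>{0..<int n}. c k)"
      by (rule sum.reindex_bij_witness[where i = nat and j = int]) auto
    finally show "T * (\<Sum>\<^sub>\<infinity>k\<in>{0..<int n}. c k) = sum G S2"
      by (simp only: infsum_finite finite_atLeastLessThan_int)
  qed (simp add: S2_def)
  have G3: "(G has_sum T * (\<Sum>\<^sub>\<infinity>k\<in>{int n..}. c k)) S3"
  proof -
    define h where "h m = c (int n + int m)" for m
    have bij: "bij_betw (\<lambda>m. int n + int m) UNIV {int n..}"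
      by (rule bij_betw_byWitness[where f' = "\<lambda>k. nat (k - int n)"]) auto
    have "(\<lambda>m. norm (h m)) summable_on UNIV"
      using c_summable[of "{int n..}"] summable_on_reindex_bij_betw[OF bij, of "\<lambda>k. norm (c k)"]
      by (simp add: h_def[abs_def])
    then have "((\<lambda>\<rho>. of_real ((1 / real q) ^ length \<rho>) * h (length \<rho>)) has_sum (\<Sum>\<^sub>\<infinity>m. h m)) (tree q)"
      by (rule has_sum_tree_radial[OF assms(1)])
    moreover have "(\<Sum>\<^sub>\<infinity>m. h m) = (\<Sum>\<^sub>\<infinity>k\<in>{int n..}. c k)"
      unfolding h_def by (rule infsum_reindex_bij_betw[OF bij])
    ultimately have "((\<lambda>\<rho>. T * (of_real ((1 / real q) ^ length \<rho>) * h (length \<rho>))) has_sum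
        T * (\<Sum>\<^sub>\<infinity>k\<in>{int n..}. c k)) (tree q)"
      by (intro has_sum_cmult_right) simp
    moreover have "T * (of_real ((1 / real q) ^ length \<rho>) * h (length \<rho>)) = G (u @ r @ \<rho>)" for \<rho>
    proof -
      define m where "m = length \<rho>"
      have "G (u @ r @ \<rho>) = of_real (t ^ m) * a (- int m) * (of_real (t ^ (n + m)) * b (int n + int m))"
        unfolding G_def tree_Toeplitz_def t_def[symmetric] by (simp add: n_def m_def)
      also have "\<dots> = T * (of_real (t ^ m * t ^ m) * h m)"
        by (simp add: T_def h_def c_def power_add)
      finally show ?thesis by (simp only: tt m_def)
    qed
    ultimately have "((G \<circ> (\<lambda>\<rho>. u @ r @ \<rho>)) has_sum T * (\<Sum>\<^sub>\<infinity>k\<in>{int n..}. c k)) (tree q)"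
      by (simp only: o_def)
    then show ?thesis
      unfolding S3_def by (subst has_sum_reindex) (auto simp: inj_on_def)
  qed
  have len1: "length \<omega> < length u" if "\<omega> \<in> S1" for \<omega>
    using that by (auto simp: S1_def)
  have len2: "length u \<le> length \<omega> \<and> length \<omega> < length u + n" if "\<omega> \<in> S2" for \<omega>
    using that by (auto simp: S2_def)
  have len3: "length u + n \<le> length \<omega>" if "\<omega> \<in> S3" for \<omega>
    using that by (auto simp: S3_def n_def)
  have disjoint: "S1 \<inter> S2 = {}" "(S1 \<union> S2) \<inter> S3 = {}"
  proof -
    have False if "\<omega> \<in> S1" "\<omega> \<in> S2" for \<omega>
      using len1[OF that(1)] len2[OF that(2)] by simp
    then show "S1 \<inter> S2 = {}" by blast
    have False if "\<omega> \<in> S1 \<union> S2" "\<omega> \<in> S3" for \<omega>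
      using that(1) len1[of \<omega>] len2[of \<omega>] len3[OF that(2)] by auto
    then show "(S1 \<union> S2) \<inter> S3 = {}" by blast
  qed
  note G123 = has_sum_Un_disjoint[OF has_sum_Un_disjoint[OF G1 G2 disjoint(1)] G3 disjoint(2)]
  have "(\<Sum>\<^sub>\<infinity>k\<in>{0..<int n} \<union> {int n..}. c k) =
      (\<Sum>\<^sub>\<infinity>k\<in>{0..<int n}. c k) + (\<Sum>\<^sub>\<infinity>k\<in>{int n..}. c k)"
    by (rule infsum_Un_disjoint[OF abs_summable_summable[OF c_summable]
          abs_summable_summable[OF c_summable]]) auto
  moreover have "{0..<int n} \<union> {int n..} = {0..}" by auto
  ultimately have split: "(\<Sum>\<^sub>\<infinity>k\<in>{0..}. c k) =
      (\<Sum>\<^sub>\<infinity>k\<in>{0..<int n}. c k) + (\<Sum>\<^sub>\<infinity>k\<in>{int n..}. c k)"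
    by (simp only:)
  have "(G has_sum T * ((\<Sum>m = 1..length u.
      of_real ((1 / real q) ^ m) * (a (int (length r + m)) * b (- int m))) +
      (\<Sum>\<^sub>\<infinity>k\<in>{0..}. c k))) (S1 \<union> S2 \<union> S3)"
    unfolding split using G123 by (simp only: distrib_left add.assoc)
  moreover have outside: "G \<omega> = 0" if "\<omega> \<in> tree q - (S1 \<union> S2 \<union> S3)" for \<omega>
  proof -
    have "\<not> prefix (u @ r) \<omega>"
    proof
      assume "prefix (u @ r) \<omega>"
      then obtain \<rho> where "\<omega> = u @ r @ \<rho>" by (auto simp: prefix_def)
      then show False using that by (auto simp: S3_def tree_append)
    qed
    moreover have "\<not> prefix \<omega> (u @ r)"
    proof
      assume "prefix \<omega> (u @ r)"
      then consider "prefix \<omega> u" | xs where "\<omega> = u @ xs" "prefix xs r"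
        by (auto simp: prefix_append)
      then show False
      proof cases
        case 1
        then have \<omega>: "\<omega> = take (length \<omega>) u" and le: "length \<omega> \<le> length u"
          by (auto simp: prefix_def)
        show False
        proof (cases "\<omega> = u")
          case True
          then have "prefix (u @ r) \<omega> \<or> \<omega> \<in> S2"
            by (cases "r = []") (auto simp: S2_def n_def image_iff intro!: bexI[of _ 0])
          then show False using that \<open>\<not> prefix (u @ r) \<omega>\<close> by auto
        next
          case False
          then have "length \<omega> \<noteq> length u" using \<omega> by auto
          then have "\<omega> \<in> S1"
            using \<omega> le unfolding S1_def
            by (intro image_eqI[of _ _ "length u - length \<omega>"]) auto
          then show False using that by auto
        qed
      next
        case 2
        then have xs: "xs = take (length xs) r" by (auto simp: prefix_def)
        show False
        proof (cases "length xs < n")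
          case True
          then have "\<omega> \<in> S2"
            using xs 2(1) unfolding S2_def by (intro image_eqI[of _ _ "length xs"]) auto
          then show False using that by auto
        next
          case False
          then have "xs = r" using xs 2(2) by (simp add: n_def)
          then show False using 2(1) \<open>\<not> prefix (u @ r) \<omega>\<close> by simp
        qed
      qed
    qed
    ultimately show ?thesis by (simp add: G_def tree_Toeplitz_def)
  qed
  moreover have "S1 \<union> S2 \<union> S3 \<subseteq> tree q"
    using assms(2) by (auto simp: S1_def S2_def S3_def tree_append tree_take)
  then have "(G has_sum S) (S1 \<union> S2 \<union> S3) \<longleftrightarrow> (G has_sum S) (tree q)" for S
    using outside by (intro has_sum_cong_neutral) auto
  ultimately have "(G has_sum T * ((\<Sum>m = 1..length u.
      of_real ((1 / real q) ^ m) * (a (int (length r + m)) * b (- int m))) +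
      (\<Sum>\<^sub>\<infinity>k\<in>{0..}. c k))) (tree q)"
    by blast
  then show ?thesis
    by (simp only: G_def[abs_def] c_def[abs_def] T_def t_def n_def)
qed

definition convolution :: "(int \<Rightarrow> complex) \<Rightarrow> (int \<Rightarrow> complex) \<Rightarrow> (int \<Rightarrow> complex) \<Rightarrow> bool" where
  "convolution a b c \<longleftrightarrow> (\<forall>n. ((\<lambda>k. a (n - k) * b k) has_sum c n) UNIV)"

text \<open>
  Transposing a kernel reverses its coefficient sequence and interchanges the factors of a product;
  this lemma transfers results on pairs \<open>(u @ r, u)\<close> to pairs \<open>(u, u @ r)\<close>.
\<close>

lemma convolution_reverse:
  assumes "convolution a b c"
  shows "convolution (\<lambda>k. b (- k)) (\<lambda>k. a (- k)) (\<lambda>k. c (- k))"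
  unfolding convolution_def
proof
  fix n
  have "a (- n - k) = a (- (k + n))" for k
    by (rule arg_cong[of _ _ a]) simp
  then have eq: "(\<lambda>k. a (- (k + n)) * b k) = (\<lambda>k. a (- n - k) * b k)" by simp
  have "((\<lambda>k. a (- (k + n)) * b k) has_sum c (- n)) UNIV"
    unfolding eq using assms by (simp only: convolution_def)
  also have "?this \<longleftrightarrow> ((\<lambda>k. b (- (n - k)) * a (- k)) has_sum c (- n)) UNIV"
    by (rule has_sum_reindex_bij_witness[where i = "\<lambda>k. k - n" and j = "\<lambda>k. k + n"])
      (auto simp: mult.commute)
  finally show "((\<lambda>k. b (- (n - k)) * a (- k)) has_sum c (- n)) UNIV" .
qed

lemma convolution_abs_summable:
  "convolution a b c \<Longrightarrow> (\<lambda>k. norm (a (n - k) * b k)) summable_on UNIV"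
  unfolding convolution_def summable_on_iff_abs_summable_on_complex[symmetric]
  by (auto dest: has_sum_imp_summable)

text \<open>
  For \<open>n \<ge> 0\<close> and \<open>k < 0\<close> the index \<open>n - k\<close> is positive, so the hypothesis removes the negative
  half of the convolution as well as the correction from the vertices above \<open>u\<close>.
\<close>

lemma tree_Toeplitz_product_below_eq:
  assumes "q > 0" "u @ r \<in> tree q" and conv: "convolution a b c"
    and zero: "\<And>s t. s \<ge> 1 \<Longrightarrow> t \<ge> 1 \<Longrightarrow> a s * b (- t) = 0"
  shows "((\<lambda>\<omega>. tree_Toeplitz q a (u @ r) \<omega> * tree_Toeplitz q b \<omega> u) has_sum
    tree_Toeplitz q c (u @ r) u) (tree q)"
proof -
  let ?n = "int (length r)"
  have "((\<lambda>k. a (?n - k) * b k) has_sum c ?n) UNIV"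
    using conv by (simp add: convolution_def)
  also have "?this \<longleftrightarrow> ((\<lambda>k. a (?n - k) * b k) has_sum c ?n) {0..}"
    using zero[of "?n - k" "- k" for k] by (intro has_sum_cong_neutral) auto
  finally have "(\<Sum>\<^sub>\<infinity>k\<in>{0..}. a (?n - k) * b k) = c ?n"
    by (rule infsumI)
  moreover have "(\<Sum>m = 1..length u. of_real ((1 / real q) ^ m) *
      (a (int (length r + m)) * b (- int m))) = 0"
    using zero by (intro sum.neutral ballI) simp
  ultimately show ?thesis
    using tree_Toeplitz_product_below[OF assms(1,2) convolution_abs_summable[OF conv]]
    by (simp add: tree_Toeplitz_def)
qed

text \<open>
  The kernel at \<open>(u @ r, u)\<close> must not depend on the depth of \<open>u\<close>. Its value at depth \<open>t\<close> differs
  from that at depth \<open>t - 1\<close> by a nonzero multiple of \<open>a\<^sub>s b\<^bsub>-t\<^esub>\<close> when \<open>|r| = s - t\<close>.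
\<close>

lemma zero_of_tree_Toeplitz_product_below:
  assumes "q > 0" and conv: "convolution a b c"
    and prod: "\<And>u r. u @ r \<in> tree q \<Longrightarrow>
      ((\<lambda>\<omega>. tree_Toeplitz q a (u @ r) \<omega> * tree_Toeplitz q b \<omega> u) has_sum
        tree_Toeplitz q c (u @ r) u) (tree q)"
    and "1 \<le> t" "t \<le> s"
  shows "a s * b (- t) = 0"
proof -
  define n where "n = nat (s - t)"
  define m where "m = nat t"
  define P where "P = (\<Sum>\<^sub>\<infinity>k\<in>{0..}. a (int n - k) * b k)"
  define D where "D j = (\<Sum>m = 1..j. of_real ((1 / real q) ^ m) * (a (int (n + m)) * b (- int m)))" for j :: nat
  have D: "D j + P = c (int n)" for j
  proof -
    define u r where "u = replicate j (0::nat)" and "r = replicate n (0::nat)"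
    have len: "length u = j" "length r = n" by (simp_all add: u_def r_def)
    have ur: "u @ r \<in> tree q" using assms(1) by (auto simp: u_def r_def tree_def)
    have "((\<lambda>\<omega>. tree_Toeplitz q a (u @ r) \<omega> * tree_Toeplitz q b \<omega> u) has_sum
        of_real ((1 / sqrt q) ^ n) * (D j + P)) (tree q)"
      using tree_Toeplitz_product_below[OF assms(1) ur convolution_abs_summable[OF conv]]
      by (simp only: len D_def P_def)
    then have "of_real ((1 / sqrt q) ^ n) * (D j + P) = tree_Toeplitz q c (u @ r) u"
      by (rule has_sum_unique[OF _ prod[OF ur]])
    also have "\<dots> = of_real ((1 / sqrt q) ^ n) * c (int n)"
      by (simp add: tree_Toeplitz_def len)
    finally show ?thesis using assms(1) by simp
  qed
  have "m \<ge> 1" "int m = t" "int (n + m) = s" using assms(4,5) by (auto simp: m_def n_def)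
  then obtain j where j: "m = Suc j" by (cases m) auto
  have "D m = D j + of_real ((1 / real q) ^ m) * (a (int (n + m)) * b (- int m))"
    unfolding D_def j by (simp del: of_nat_Suc of_nat_add power_Suc)
  moreover have "D m = D j" using D[of j] D[of m] by (metis add_right_cancel)
  ultimately have "of_real ((1 / real q) ^ m) * (a (int (n + m)) * b (- int m)) = 0"
    by (metis add_cancel_left_right)
  then show ?thesis
    using assms(1) \<open>int m = t\<close> \<open>int (n + m) = s\<close> by simp
qed

text \<open>
  Pairs \<open>(u @ r, u)\<close> control the products \<open>a\<^sub>s b\<^bsub>-t\<^esub>\<close> with \<open>t \<le> s\<close> and the transposed pairs those
  with \<open>s \<le> t\<close>. At an incomparable pair only the common ancestors contribute, and each of them
  contributes a multiple of such a product.
\<close>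

theorem tree_Toeplitz_product_iff:
  assumes "q > 0" and conv: "convolution a b c"
  shows "(\<forall>\<sigma>\<in>tree q. \<forall>\<tau>\<in>tree q.
      ((\<lambda>\<omega>. tree_Toeplitz q a \<sigma> \<omega> * tree_Toeplitz q b \<omega> \<tau>) has_sum tree_Toeplitz q c \<sigma> \<tau>) (tree q))
    \<longleftrightarrow> (\<forall>s\<ge>1. \<forall>t\<ge>1. a s * b (- t) = 0)"
proof -
  let ?a = "\<lambda>k. a (- k)" and ?b = "\<lambda>k. b (- k)" and ?c = "\<lambda>k. c (- k)"
  note conv' = convolution_reverse[OF conv]
  have swap: "((\<lambda>\<omega>. tree_Toeplitz q a \<sigma> \<omega> * tree_Toeplitz q b \<omega> \<tau>) has_sum tree_Toeplitz q c \<sigma> \<tau>) (tree q)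
      \<longleftrightarrow> ((\<lambda>\<omega>. tree_Toeplitz q ?b \<tau> \<omega> * tree_Toeplitz q ?a \<omega> \<sigma>) has_sum tree_Toeplitz q ?c \<tau> \<sigma>) (tree q)"
    for \<sigma> \<tau>
    unfolding tree_Toeplitz_transpose[of q a \<sigma>] tree_Toeplitz_transpose[of q b _ \<tau>]
      tree_Toeplitz_transpose[of q c \<sigma>] by (simp only: mult.commute)
  show ?thesis
  proof (intro iffI allI impI ballI)
    fix s t :: int assume st: "1 \<le> s" "1 \<le> t"
      and prod: "\<forall>\<sigma>\<in>tree q. \<forall>\<tau>\<in>tree q.
        ((\<lambda>\<omega>. tree_Toeplitz q a \<sigma> \<omega> * tree_Toeplitz q b \<omega> \<tau>) has_sum tree_Toeplitz q c \<sigma> \<tau>) (tree q)"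
    show "a s * b (- t) = 0"
    proof (cases "t \<le> s")
      case True
      show ?thesis
        by (rule zero_of_tree_Toeplitz_product_below[OF assms(1) conv _ st(2) True])
          (use prod in \<open>simp add: tree_append\<close>)
    next
      case False
      have "b (- t) * a (- (- s)) = 0"
        by (rule zero_of_tree_Toeplitz_product_below[OF assms(1) conv' _ st(1)])
          (use prod False in \<open>simp_all add: tree_append flip: swap\<close>)
      then show ?thesis by (simp add: disj_commute)
    qed
  next
    fix \<sigma> \<tau> assume \<sigma>\<tau>: "\<sigma> \<in> tree q" "\<tau> \<in> tree q"
      and zero: "\<forall>s\<ge>1. \<forall>t\<ge>1. a s * b (- t) = 0"
    consider "prefix \<tau> \<sigma>" | "prefix \<sigma> \<tau>" | "\<not> prefix \<sigma> \<tau>" "\<not> prefix \<tau> \<sigma>" by blast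
    then show "((\<lambda>\<omega>. tree_Toeplitz q a \<sigma> \<omega> * tree_Toeplitz q b \<omega> \<tau>) has_sum tree_Toeplitz q c \<sigma> \<tau>) (tree q)"
    proof cases
      case 1
      then obtain r where r: "\<sigma> = \<tau> @ r" by (auto simp: prefix_def)
      show ?thesis
        unfolding r
        by (rule tree_Toeplitz_product_below_eq[OF assms(1) _ conv]) (use \<sigma>\<tau>(1) r zero in auto)
    next
      case 2
      then obtain r where r: "\<tau> = \<sigma> @ r" by (auto simp: prefix_def)
      have zero': "b (- s) * a (- (- t)) = 0" if "s \<ge> 1" "t \<ge> 1" for s t
        using zero[rule_format, OF that(2,1)] by (simp add: disj_commute)
      show ?thesis
        unfolding swap unfolding r
        by (rule tree_Toeplitz_product_below_eq[OF assms(1) _ conv' zero']) (use \<sigma>\<tau>(2) r in auto)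
    next
      case 3
      have "tree_Toeplitz q a \<sigma> \<omega> * tree_Toeplitz q b \<omega> \<tau> = 0" for \<omega>
      proof (cases "prefix \<sigma> \<omega> \<or> prefix \<tau> \<omega>")
        case True
        with 3 have "\<not> (prefix \<sigma> \<omega> \<or> prefix \<omega> \<sigma>) \<or> \<not> (prefix \<omega> \<tau> \<or> prefix \<tau> \<omega>)"
          using prefix_same_cases[of \<sigma> \<omega> \<tau>] prefix_order.trans by blast
        then show ?thesis by (auto simp: tree_Toeplitz_def)
      next
        case False
        show ?thesis
        proof (cases "prefix \<omega> \<sigma> \<and> prefix \<omega> \<tau>")
          case True
          with False have "length \<omega> < length \<sigma>" "length \<omega> < length \<tau>"
            by (auto intro!: prefix_length_less simp: strict_prefix_def)
          then have "a (int (length \<sigma>) - int (length \<omega>)) *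
              b (- (int (length \<tau>) - int (length \<omega>))) = 0"
            by (intro zero[rule_format]) auto
          then show ?thesis by (auto simp: tree_Toeplitz_def)
        next
          case no: False
          with False show ?thesis by (auto simp: tree_Toeplitz_def)
        qed
      qed
      moreover have "tree_Toeplitz q c \<sigma> \<tau> = 0"
        using 3 by (simp add: tree_Toeplitz_def)
      ultimately show ?thesis by (simp only: has_sum_0)
    qed
  qed
qed

section \<open>Multiplicativity and analyticity\<close>

theorem theorem1p3:
  fixes q :: nat and f g :: "complex \<Rightarrow> complex"
  assumes "q \<ge> 2" and "f \<in> Linf" and "g \<in> Linf"
  shows "Gamma_op q (\<lambda>z. cnj (f z) * g z) =
           compose (ell2 q) (Gamma_op q (\<lambda>z. cnj (f z))) (Gamma_op q g)
         \<longleftrightarrow> f \<in> Hinf \<or> g \<in> Hinf"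
proof -
  have q: "q > 0" using assms(1) by simp
  let ?F = "\<lambda>z. cnj (f z)" and ?H = "\<lambda>z. cnj (f z) * g z"
  have F: "?F \<in> Linf" and H: "?H \<in> Linf" using assms(2,3) by simp_all
  let ?a = "fourier_coeff ?F" and ?b = "fourier_coeff g" and ?c = "fourier_coeff ?H"
  let ?AB = "compose (ell2 q) (Gamma_op q ?F) (Gamma_op q g)"
  note bF = Gamma_op_bounded[OF q F] and bg = Gamma_op_bounded[OF q assms(3)]
    and bH = Gamma_op_bounded[OF q H]
  have AB: "?AB \<in> bounded_operators q"
    by (rule compose_bounded_operators[OF bF(1) bg(1)])
  have AB_kernel: "((\<lambda>\<omega>. tree_Toeplitz q ?a \<sigma> \<omega> * tree_Toeplitz q ?b \<omega> \<tau>) has_sum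
      kernel_of q ?AB \<sigma> \<tau>) (tree q)" if "\<sigma> \<in> tree q" "\<tau> \<in> tree q" for \<sigma> \<tau>
    using kernel_of_compose_has_sum[OF bF(1) bg(1) that]
    by (rule has_sum_cong[THEN iffD1, rotated]) (simp add: bF(2) bg(2) that)
  have "Gamma_op q ?H = ?AB \<longleftrightarrow>
      (\<forall>\<sigma>\<in>tree q. \<forall>\<tau>\<in>tree q. kernel_of q ?AB \<sigma> \<tau> = tree_Toeplitz q ?c \<sigma> \<tau>)"
  proof
    assume eq: "Gamma_op q ?H = ?AB"
    show "\<forall>\<sigma>\<in>tree q. \<forall>\<tau>\<in>tree q. kernel_of q ?AB \<sigma> \<tau> = tree_Toeplitz q ?c \<sigma> \<tau>"
      unfolding eq[symmetric] using bH(2) by blast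
  next
    assume "\<forall>\<sigma>\<in>tree q. \<forall>\<tau>\<in>tree q. kernel_of q ?AB \<sigma> \<tau> = tree_Toeplitz q ?c \<sigma> \<tau>"
    then show "Gamma_op q ?H = ?AB"
      by (intro bounded_operator_eqI[OF bH(1) AB]) (simp only: bH(2))
  qed
  also have "\<dots> \<longleftrightarrow> (\<forall>\<sigma>\<in>tree q. \<forall>\<tau>\<in>tree q.
      ((\<lambda>\<omega>. tree_Toeplitz q ?a \<sigma> \<omega> * tree_Toeplitz q ?b \<omega> \<tau>) has_sum
        tree_Toeplitz q ?c \<sigma> \<tau>) (tree q))"
  proof (intro ball_cong refl iffI)
    fix \<sigma> \<tau> assume \<sigma>\<tau>: "\<sigma> \<in> tree q" "\<tau> \<in> tree q"
    show "((\<lambda>\<omega>. tree_Toeplitz q ?a \<sigma> \<omega> * tree_Toeplitz q ?b \<omega> \<tau>) has_sum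
        tree_Toeplitz q ?c \<sigma> \<tau>) (tree q)"
      if "kernel_of q ?AB \<sigma> \<tau> = tree_Toeplitz q ?c \<sigma> \<tau>"
      using AB_kernel[OF \<sigma>\<tau>] unfolding that .
    show "kernel_of q ?AB \<sigma> \<tau> = tree_Toeplitz q ?c \<sigma> \<tau>"
      if "((\<lambda>\<omega>. tree_Toeplitz q ?a \<sigma> \<omega> * tree_Toeplitz q ?b \<omega> \<tau>) has_sum
        tree_Toeplitz q ?c \<sigma> \<tau>) (tree q)"
      by (rule has_sum_unique[OF AB_kernel[OF \<sigma>\<tau>] that])
  qed
  also have "\<dots> \<longleftrightarrow> (\<forall>s\<ge>1. \<forall>t\<ge>1. ?a s * ?b (- t) = 0)"
    by (rule tree_Toeplitz_product_iff[OF q])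
      (simp add: convolution_def has_sum_fourier_coeff_mult[OF F assms(3)])
  also have "\<dots> \<longleftrightarrow> (\<forall>s\<ge>1. fourier_coeff f (- s) = 0) \<or> (\<forall>t\<ge>1. fourier_coeff g (- t) = 0)"
    by (auto simp: fourier_coeff_cnj)
  also have "\<dots> \<longleftrightarrow> f \<in> Hinf \<or> g \<in> Hinf"
  proof -
    have "(\<forall>s\<ge>1. fourier_coeff h (- s) = 0) \<longleftrightarrow> (\<forall>n<0. fourier_coeff h n = 0)" for h
    proof (intro iffI allI impI)
      fix n :: int assume "\<forall>s\<ge>1. fourier_coeff h (- s) = 0" "n < 0"
      then show "fourier_coeff h n = 0" by (auto dest: spec[of _ "- n"])
    qed simp
    then show ?thesis using assms(2,3) by (simp add: Hinf_def)
  qed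
  finally show ?thesis .
qed

end
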